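(* Suppose that $n_h\to n_0$ in $L^{3/2}(B)$ as $h\to0$, and suppose that there is no nontrivial $w\in H^1(B)$ satisfying $\Delta w+k^2n_0w=0$ in $B$ and $w=0$ on $\partial B$. Let $\lambda_0$ be a nonzero simple $\delta$-Stekloff eigenvalue for $(A,n)=(I,n_0)$ with $H^1(B)$-normalized eigenfunction $u_0$, and for sufficiently small $h>0$ let $\lambda_h$ be the simple $\delta$-Stekloff eigenvalue for $(A,n)=(I,n_h)$ that satisfies, as $h\to0$, $$\lambda_h=\lambda_0+\frac{k^2((n_h-n_0)u_0,u_0)_B}{\langle S_\delta u_0,u_0\rangle_{\partial B}}+O\left(\|n_h-n_0\|_{L^{p'}(B)}^2\right),$$ where $p'=1+\epsilon$ for any given $\epsilon>0$ if $d=2$ (with the $O$-constant depending on $\epsilon$) and $p'=\frac65$ if $d=3$. Then there is a constant $C$ independent of $h$ such that for sufficiently small $h>0$ $$|\lambda_h-\lambda_0|\le C\|n_h-n_0\|_{L^1(B)}.$$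
   Context: Setting. $d\in\{2,3\}$; $B\subseteq\mathbb{R}^d$ is a bounded domain with connected exterior $\mathbb{R}^d\setminus\overline B$ and smooth boundary $\partial B$ (connected if $d=2$, simply connected if $d=3$) with unit outward normal $\nu$; $D\subseteq\mathbb{R}^d$ is a bounded Lipschitz domain with connected exterior, compactly contained in $B$; $k>0$ and $\delta\ge0$ are fixed. All functions are complex-valued; $(f_1,f_2)_B=\int_B f_1\overline{f_2}\,dx$ (with the dot product for vector fields), and $\langle f_1,f_2\rangle_{\partial B}=\int_{\partial B}f_1\overline{f_2}\,ds$. Coefficients (isotropic case). $\{n_h\}_{h\ge0}$ is a family such that for every $h\ge0$, $n_h\in L^\infty(\mathbb{R}^d)$, $\mathrm{Re}(n_h)\ge\alpha>0$ and $\mathrm{Im}(n_h)\ge0$ a.e. in $D$, and $n_h=1$ in $B\setminus\overline D$. The matrix coefficient is $A_h=I$ for all $h\ge0$. Smoothing operator. $\Delta_{\partial B}=-\mathrm{div}_{\partial B}\nabla_{\partial B}$ is the nonnegative Laplace–Beltrami operator on $\partial B$, with $L^2(\partial B)$-orthonormal eigenbasis $\{Y_m\}_{m\ge0}$ and eigenvalues $0=\mu_0<\mu_1\le\mu_2\le\cdots\to\infty$; $S_\delta\xi=\sum_{m\ge0}(1+\mu_m)^{-\delta}\langle\xi,Y_m\rangle_{\partial B}Y_m$. For $u\in H^1(B)$, $S_\delta u$ means $S_\delta$ applied to the trace of $u$. Eigenvalue problem. $\lambda\in\mathbb{C}$ is a $\delta$-Stekloff eigenvalue for $(I,n)$ with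 eigenfunction $u$ if $0\ne u\in H^1(B)$ satisfies (weakly) $\Delta u+k^2nu=0$ in $B$ and $\frac{\partial u}{\partial\nu}+\lambda S_\delta u=0$ on $\partial B$. Operators and simplicity. $H^1(B)$ carries the inner product $(u,u')_{H^1(B)}=(\nabla u,\nabla u')_B+k^2(u,u')_B$, and normalization is with respect to it. Operators $\mathbb{K}_h,\mathbb{B}:H^1(B)\to H^1(B)$ are defined by $(\mathbb{K}_hu,u')_{H^1(B)}=-k^2((n_h+1)u,u')_B$ and $(\mathbb{B}u,u')_{H^1(B)}=-\langle S_\delta u,u'\rangle_{\partial B}$ for all $u,u'\in H^1(B)$, and $T_h(\lambda)=-\lambda^{-1}\mathbb{K}_h+\mathbb{B}$ for $\lambda\ne0$. A nonzero $\lambda$ is a $\delta$-Stekloff eigenvalue for $(I,n_h)$ iff $\lambda T_h(\lambda)u=u$ for some $u\ne0$; it is simple if the spectral projection of $T_h(\lambda)$ at its eigenvalue $\lambda^{-1}$ has one-dimensional range. Existence of $\lambda_h$. Under the hypotheses of the claim, the paper's preceding theorem provides, for sufficiently small $h>0$, a simple eigenvalue $\lambda_h$ with the stated expansion. *)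

theory Defs
  imports "HOL-Complex_Analysis.Complex_Analysis" "HOL-Library.Landau_Symbols"
begin

text \<open>
  Elements of \<open>L\<^sup>2\<close> and \<open>H\<^sup>1\<close> are represented by functions, and equality of such elements is
  equality almost everywhere. Constants below that are introduced by Hilbert choice (weak gradient,
  trace, solution operators, resolvent, spectral projection) are determined up to null sets, so
  that the choice of representative does not affect any integral or any almost-everywhere statement.
\<close>


subsection \<open>Smooth functions\<close>

definition partial_deriv :: "'n::finite \<Rightarrow> (real^'n \<Rightarrow> 'b::real_normed_vector) \<Rightarrow> real^'n \<Rightarrow> 'b" where
  "partial_deriv i f x = frechet_derivative f (at x) (axis i 1)"

definition gradient :: "(real^'n \<Rightarrow> 'b::real_normed_vector) \<Rightarrow> real^'n \<Rightarrow> 'b^'n::finite" where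
  "gradient f x = (\<chi> i. partial_deriv i f x)"

primrec continuously_differentiable :: "nat \<Rightarrow> (real^'n::finite \<Rightarrow> 'b::real_normed_vector) \<Rightarrow> bool" where
  "continuously_differentiable 0 f \<longleftrightarrow> continuous_on UNIV f"
| "continuously_differentiable (Suc m) f \<longleftrightarrow>
     (\<forall>x. f differentiable (at x)) \<and> (\<forall>i. continuously_differentiable m (partial_deriv i f))"

definition smooth :: "(real^'n::finite \<Rightarrow> 'b::real_normed_vector) \<Rightarrow> bool" where
  "smooth f \<longleftrightarrow> (\<forall>m. continuously_differentiable m f)"

definition test_function :: "(real^'n::finite) set \<Rightarrow> (real^'n \<Rightarrow> complex) \<Rightarrow> bool" where
  "test_function B \<phi> \<longleftrightarrow> smooth \<phi> \<and> (\<exists>K. compact K \<and> K \<subseteq> B \<and> (\<forall>x. x \<notin> K \<longrightarrow> \<phi> x = 0))"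


subsection \<open>Domains\<close>

definition bounded_domain :: "(real^'n::finite) set \<Rightarrow> bool" where
  "bounded_domain U \<longleftrightarrow> open U \<and> connected U \<and> bounded U \<and> U \<noteq> {}"

text \<open>
  Near \<open>x\<close> the set \<open>U\<close> is the part below the graph of \<open>\<gamma>\<close> in the direction of the unit vector \<open>e\<close>;
  \<open>\<gamma>\<close> is only evaluated on the hyperplane orthogonal to \<open>e\<close>.
\<close>
definition graph_chart ::
    "(real^'n::finite) set \<Rightarrow> real^'n \<Rightarrow> real \<Rightarrow> real^'n \<Rightarrow> (real^'n \<Rightarrow> real) \<Rightarrow> bool" where
  "graph_chart U x r e \<gamma> \<longleftrightarrow> 0 < r \<and> norm e = 1 \<and>
     U \<inter> ball x r = {y \<in> ball x r. y \<bullet> e < \<gamma> (y - (y \<bullet> e) *\<^sub>R e)}"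

definition smooth_boundary :: "(real^'n::finite) set \<Rightarrow> bool" where
  "smooth_boundary U \<longleftrightarrow> (\<forall>x \<in> frontier U. \<exists>r e \<gamma>. graph_chart U x r e \<gamma> \<and> smooth \<gamma>)"

definition lipschitz_boundary :: "(real^'n::finite) set \<Rightarrow> bool" where
  "lipschitz_boundary U \<longleftrightarrow>
     (\<forall>x \<in> frontier U. \<exists>r e \<gamma> L. graph_chart U x r e \<gamma> \<and> L-lipschitz_on UNIV \<gamma>)"

definition outward_normal :: "(real^'n::finite) set \<Rightarrow> real^'n \<Rightarrow> real^'n" where
  "outward_normal U x = (THE \<nu>. \<exists>r e \<gamma>. graph_chart U x r e \<gamma> \<and> smooth \<gamma> \<and>
     \<nu> = sgn (gradient (\<lambda>y. y \<bullet> e - \<gamma> (y - (y \<bullet> e) *\<^sub>R e)) x))"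


subsection \<open>Lebesgue spaces and surface measure\<close>

definition L2 :: "'a measure \<Rightarrow> ('a \<Rightarrow> complex) \<Rightarrow> bool" where
  "L2 M f \<longleftrightarrow> f \<in> borel_measurable M \<and> integrable M (\<lambda>x. (norm (f x))\<^sup>2)"

definition L2_inner :: "'a measure \<Rightarrow> ('a \<Rightarrow> complex) \<Rightarrow> ('a \<Rightarrow> complex) \<Rightarrow> complex" where
  "L2_inner M f g = (LINT x|M. f x * cnj (g x))"

definition L2_inner_vec ::
    "'a measure \<Rightarrow> ('a \<Rightarrow> complex^'n::finite) \<Rightarrow> ('a \<Rightarrow> complex^'n) \<Rightarrow> complex" where
  "L2_inner_vec M f g = (LINT x|M. (\<Sum>i\<in>UNIV. f x $ i * cnj (g x $ i)))"

definition L2_norm :: "'a measure \<Rightarrow> ('a \<Rightarrow> complex) \<Rightarrow> real" where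
  "L2_norm M f = sqrt (LINT x|M. (norm (f x))\<^sup>2)"

definition Lp_norm :: "real \<Rightarrow> 'a measure \<Rightarrow> ('a \<Rightarrow> complex) \<Rightarrow> real" where
  "Lp_norm p M f = (LINT x|M. norm (f x) powr p) powr (1 / p)"

definition Linfty :: "'a measure \<Rightarrow> ('a \<Rightarrow> complex) \<Rightarrow> bool" where
  "Linfty M f \<longleftrightarrow> f \<in> borel_measurable M \<and> (\<exists>C. AE x in M. norm (f x) \<le> C)"

text \<open>
  Hausdorff measure, normalised so that the \<open>s\<close>-dimensional measure is \<open>s\<close>-dimensional area.
  Covering sets are required to be bounded because \<^const>\<open>diameter\<close> is unspecified otherwise.
\<close>
definition hausdorff_outer :: "nat \<Rightarrow> 'a::metric_space set \<Rightarrow> ennreal" where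
  "hausdorff_outer s A = (SUP \<epsilon>\<in>{0<..}.
     INF C\<in>{C :: nat \<Rightarrow> 'a set. A \<subseteq> (\<Union>i. C i) \<and> (\<forall>i. bounded (C i) \<and> diameter (C i) \<le> \<epsilon>)}.
       \<Sum>i. ennreal (unit_ball_vol (real s) * (diameter (C i) / 2) ^ s))"

definition hausdorff_measure :: "nat \<Rightarrow> 'a::metric_space measure" where
  "hausdorff_measure s = measure_of UNIV (sets borel) (hausdorff_outer s)"

definition surface :: "(real^'n::finite) set \<Rightarrow> (real^'n) measure" where
  "surface B = restrict_space (hausdorff_measure (CARD('n) - 1)) (frontier B)"


subsection \<open>The Sobolev space \<open>H\<^sup>1(B)\<close> and traces\<close>

definition is_weak_gradient ::
    "(real^'n::finite) set \<Rightarrow> (real^'n \<Rightarrow> complex) \<Rightarrow> (real^'n \<Rightarrow> complex^'n) \<Rightarrow> bool" where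
  "is_weak_gradient B u g \<longleftrightarrow> (\<forall>\<phi> i. test_function B \<phi> \<longrightarrow>
     (LINT x|lebesgue_on B. u x * partial_deriv i \<phi> x) = - (LINT x|lebesgue_on B. g x $ i * \<phi> x))"

definition is_L2_weak_gradient ::
    "(real^'n::finite) set \<Rightarrow> (real^'n \<Rightarrow> complex) \<Rightarrow> (real^'n \<Rightarrow> complex^'n) \<Rightarrow> bool" where
  "is_L2_weak_gradient B u g \<longleftrightarrow> (\<forall>i. L2 (lebesgue_on B) (\<lambda>x. g x $ i)) \<and> is_weak_gradient B u g"

definition H1 :: "(real^'n::finite) set \<Rightarrow> (real^'n \<Rightarrow> complex) set" where
  "H1 B = {u. L2 (lebesgue_on B) u \<and> (\<exists>g. is_L2_weak_gradient B u g)}"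

definition weak_gradient :: "(real^'n::finite) set \<Rightarrow> (real^'n \<Rightarrow> complex) \<Rightarrow> real^'n \<Rightarrow> complex^'n" where
  "weak_gradient B u = (SOME g. is_L2_weak_gradient B u g)"

definition H1_inner ::
    "(real^'n::finite) set \<Rightarrow> real \<Rightarrow> (real^'n \<Rightarrow> complex) \<Rightarrow> (real^'n \<Rightarrow> complex) \<Rightarrow> complex" where
  "H1_inner B k u v = L2_inner_vec (lebesgue_on B) (weak_gradient B u) (weak_gradient B v)
     + of_real (k\<^sup>2) * L2_inner (lebesgue_on B) u v"

definition H1_norm :: "(real^'n::finite) set \<Rightarrow> real \<Rightarrow> (real^'n \<Rightarrow> complex) \<Rightarrow> real" where
  "H1_norm B k u = sqrt (Re (H1_inner B k u u))"

definition ae_eq_on ::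
    "(real^'n::finite) set \<Rightarrow> (real^'n \<Rightarrow> complex) \<Rightarrow> (real^'n \<Rightarrow> complex) \<Rightarrow> bool" where
  "ae_eq_on B u v \<longleftrightarrow> (AE x in lebesgue_on B. u x = v x)"

text \<open>
  The trace is the continuous extension to \<open>H\<^sup>1(B)\<close> of the restriction of smooth functions to the
  boundary. All the norms \<^term>\<open>H1_norm B k\<close> with \<open>k > 0\<close> are equivalent; \<open>k = 1\<close> is used here.
\<close>
definition has_trace :: "(real^'n::finite) set \<Rightarrow> (real^'n \<Rightarrow> complex) \<Rightarrow> (real^'n \<Rightarrow> complex) \<Rightarrow> bool" where
  "has_trace B u g \<longleftrightarrow> u \<in> H1 B \<and> L2 (surface B) g \<and>
     (\<exists>\<phi> :: nat \<Rightarrow> real^'n \<Rightarrow> complex. (\<forall>j. smooth (\<phi> j)) \<and>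
        (\<lambda>j. H1_norm B 1 (\<lambda>x. \<phi> j x - u x)) \<longlonglongrightarrow> 0 \<and>
        (\<lambda>j. L2_norm (surface B) (\<lambda>x. \<phi> j x - g x)) \<longlonglongrightarrow> 0)"

definition boundary_trace :: "(real^'n::finite) set \<Rightarrow> (real^'n \<Rightarrow> complex) \<Rightarrow> real^'n \<Rightarrow> complex" where
  "boundary_trace B u = (SOME g. has_trace B u g)"


subsection \<open>Laplace--Beltrami operator and the smoothing operator\<close>

text \<open>
  The boundary is a compact hypersurface, so smooth functions on it are the restrictions of smooth
  functions on the whole space. The surface gradient is the tangential part of the gradient of any
  extension, and the surface divergence is the trace of the componentwise surface gradient.
\<close>
definition surface_smooth :: "(real^'n::finite) set \<Rightarrow> (real^'n \<Rightarrow> complex) \<Rightarrow> bool" where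
  "surface_smooth B f \<longleftrightarrow> (\<exists>F. smooth F \<and> (\<forall>y\<in>frontier B. F y = f y))"

definition surface_gradient ::
    "(real^'n::finite) set \<Rightarrow> (real^'n \<Rightarrow> complex) \<Rightarrow> real^'n \<Rightarrow> complex^'n" where
  "surface_gradient B f x =
     (let F = (SOME F. smooth F \<and> (\<forall>y\<in>frontier B. F y = f y));
          g = gradient F x; \<nu> = outward_normal B x
      in \<chi> i. g $ i - (\<Sum>j\<in>UNIV. g $ j * of_real (\<nu> $ j)) * of_real (\<nu> $ i))"

definition surface_divergence ::
    "(real^'n::finite) set \<Rightarrow> (real^'n \<Rightarrow> complex^'n) \<Rightarrow> real^'n \<Rightarrow> complex" where
  "surface_divergence B v x = (\<Sum>i\<in>UNIV. surface_gradient B (\<lambda>y. v y $ i) x $ i)"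

definition laplace_beltrami :: "(real^'n::finite) set \<Rightarrow> (real^'n \<Rightarrow> complex) \<Rightarrow> real^'n \<Rightarrow> complex" where
  "laplace_beltrami B f x = - surface_divergence B (surface_gradient B f) x"

definition laplace_beltrami_eigenbasis ::
    "(real^'n::finite) set \<Rightarrow> (nat \<Rightarrow> real) \<Rightarrow> (nat \<Rightarrow> real^'n \<Rightarrow> complex) \<Rightarrow> bool" where
  "laplace_beltrami_eigenbasis B \<mu> Y \<longleftrightarrow>
     (\<forall>m. surface_smooth B (Y m)) \<and>
     (\<forall>m. \<forall>x\<in>frontier B. laplace_beltrami B (Y m) x = of_real (\<mu> m) * Y m x) \<and>
     \<mu> 0 = 0 \<and> 0 < \<mu> 1 \<and> incseq \<mu> \<and> filterlim \<mu> at_top sequentially \<and>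
     (\<forall>m l. L2_inner (surface B) (Y m) (Y l) = (if m = l then 1 else 0)) \<and>
     (\<forall>f. L2 (surface B) f \<longrightarrow>
        (\<lambda>N. L2_norm (surface B)
           (\<lambda>x. (\<Sum>m<N. L2_inner (surface B) f (Y m) * Y m x) - f x)) \<longlonglongrightarrow> 0)"

definition smoothing ::
    "(real^'n::finite) set \<Rightarrow> (nat \<Rightarrow> real) \<Rightarrow> (nat \<Rightarrow> real^'n \<Rightarrow> complex) \<Rightarrow> real
      \<Rightarrow> (real^'n \<Rightarrow> complex) \<Rightarrow> real^'n \<Rightarrow> complex" where
  "smoothing B \<mu> Y \<delta> \<xi> = (SOME \<eta>. L2 (surface B) \<eta> \<and>
     (\<lambda>N. L2_norm (surface B)
        (\<lambda>x. (\<Sum>m<N. of_real ((1 + \<mu> m) powr (- \<delta>)) * L2_inner (surface B) \<xi> (Y m) * Y m x) - \<eta> x))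
     \<longlonglongrightarrow> 0)"

text \<open>The form \<open>\<langle>S\<^sub>\<delta> u, v\<rangle>\<close> over the boundary, for \<open>u, v\<close> in \<open>H\<^sup>1(B)\<close>.\<close>
definition smoothing_form ::
    "(real^'n::finite) set \<Rightarrow> (nat \<Rightarrow> real) \<Rightarrow> (nat \<Rightarrow> real^'n \<Rightarrow> complex) \<Rightarrow> real
      \<Rightarrow> (real^'n \<Rightarrow> complex) \<Rightarrow> (real^'n \<Rightarrow> complex) \<Rightarrow> complex" where
  "smoothing_form B \<mu> Y \<delta> u v =
     L2_inner (surface B) (smoothing B \<mu> Y \<delta> (boundary_trace B u)) (boundary_trace B v)"


subsection \<open>The eigenvalue problem\<close>

definition weak_helmholtz ::
    "(real^'n::finite) set \<Rightarrow> real \<Rightarrow> (real^'n \<Rightarrow> complex) \<Rightarrow> (real^'n \<Rightarrow> complex) \<Rightarrow> bool" where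
  "weak_helmholtz B k n u \<longleftrightarrow> (\<forall>\<phi>. test_function B \<phi> \<longrightarrow>
     L2_inner_vec (lebesgue_on B) (weak_gradient B u) (gradient \<phi>)
       = of_real (k\<^sup>2) * L2_inner (lebesgue_on B) (\<lambda>x. n x * u x) \<phi>)"

text \<open>
  For \<open>u\<close> with \<open>\<Delta>u = - k\<^sup>2 n u\<close> the weak normal derivative is the functional given by Green's
  identity, \<open>\<langle>\<partial>u/\<partial>\<nu>, v\<rangle> = (\<nabla>u, \<nabla>v) - k\<^sup>2 (n u, v)\<close>.
\<close>
definition weak_normal_derivative ::
    "(real^'n::finite) set \<Rightarrow> real \<Rightarrow> (real^'n \<Rightarrow> complex)
      \<Rightarrow> (real^'n \<Rightarrow> complex) \<Rightarrow> (real^'n \<Rightarrow> complex) \<Rightarrow> complex" where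
  "weak_normal_derivative B k n u v =
     L2_inner_vec (lebesgue_on B) (weak_gradient B u) (weak_gradient B v)
       - of_real (k\<^sup>2) * L2_inner (lebesgue_on B) (\<lambda>x. n x * u x) v"

definition stekloff_eigenfunction ::
    "(real^'n::finite) set \<Rightarrow> real \<Rightarrow> (nat \<Rightarrow> real) \<Rightarrow> (nat \<Rightarrow> real^'n \<Rightarrow> complex) \<Rightarrow> real
      \<Rightarrow> (real^'n \<Rightarrow> complex) \<Rightarrow> complex \<Rightarrow> (real^'n \<Rightarrow> complex) \<Rightarrow> bool" where
  "stekloff_eigenfunction B k \<mu> Y \<delta> n lam u \<longleftrightarrow>
     u \<in> H1 B \<and> \<not> ae_eq_on B u (\<lambda>_. 0) \<and> weak_helmholtz B k n u \<and>
     (\<forall>v\<in>H1 B. weak_normal_derivative B k n u v + lam * smoothing_form B \<mu> Y \<delta> u v = 0)"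


subsection \<open>Operators on \<open>H\<^sup>1(B)\<close> and simple eigenvalues\<close>

definition K_op ::
    "(real^'n::finite) set \<Rightarrow> real \<Rightarrow> (real^'n \<Rightarrow> complex) \<Rightarrow> (real^'n \<Rightarrow> complex) \<Rightarrow> real^'n \<Rightarrow> complex" where
  "K_op B k n u = (SOME w. w \<in> H1 B \<and> (\<forall>v\<in>H1 B.
     H1_inner B k w v = - of_real (k\<^sup>2) * L2_inner (lebesgue_on B) (\<lambda>x. (n x + 1) * u x) v))"

definition B_op ::
    "(real^'n::finite) set \<Rightarrow> real \<Rightarrow> (nat \<Rightarrow> real) \<Rightarrow> (nat \<Rightarrow> real^'n \<Rightarrow> complex) \<Rightarrow> real
      \<Rightarrow> (real^'n \<Rightarrow> complex) \<Rightarrow> real^'n \<Rightarrow> complex" where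
  "B_op B k \<mu> Y \<delta> u = (SOME w. w \<in> H1 B \<and> (\<forall>v\<in>H1 B.
     H1_inner B k w v = - smoothing_form B \<mu> Y \<delta> u v))"

definition T_op ::
    "(real^'n::finite) set \<Rightarrow> real \<Rightarrow> (nat \<Rightarrow> real) \<Rightarrow> (nat \<Rightarrow> real^'n \<Rightarrow> complex) \<Rightarrow> real
      \<Rightarrow> (real^'n \<Rightarrow> complex) \<Rightarrow> complex \<Rightarrow> (real^'n \<Rightarrow> complex) \<Rightarrow> real^'n \<Rightarrow> complex" where
  "T_op B k \<mu> Y \<delta> n lam u = (\<lambda>x. - inverse lam * K_op B k n u x + B_op B k \<mu> Y \<delta> u x)"

definition H1_resolvent_set ::
    "(real^'n::finite) set \<Rightarrow> real \<Rightarrow> ((real^'n \<Rightarrow> complex) \<Rightarrow> real^'n \<Rightarrow> complex) \<Rightarrow> complex set" where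
  "H1_resolvent_set B k T = {z.
     (\<forall>f\<in>H1 B. \<exists>u\<in>H1 B. ae_eq_on B (\<lambda>x. z * u x - T u x) f) \<and>
     (\<exists>C. \<forall>u\<in>H1 B. H1_norm B k u \<le> C * H1_norm B k (\<lambda>x. z * u x - T u x))}"

definition H1_resolvent ::
    "(real^'n::finite) set \<Rightarrow> ((real^'n \<Rightarrow> complex) \<Rightarrow> real^'n \<Rightarrow> complex) \<Rightarrow> complex
      \<Rightarrow> (real^'n \<Rightarrow> complex) \<Rightarrow> real^'n \<Rightarrow> complex" where
  "H1_resolvent B T z f = (SOME u. u \<in> H1 B \<and> ae_eq_on B (\<lambda>x. z * u x - T u x) f)"

text \<open>
  The Riesz projection \<open>(2\<pi>i)\<^sup>-\<^sup>1 \<integral> (z - T)\<^sup>-\<^sup>1 dz\<close> over the circle of radius \<open>r\<close> around \<open>z0\<close>; the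
  vector-valued integral is taken weakly, that is, tested against all elements of \<open>H\<^sup>1(B)\<close>.
\<close>
definition spectral_projection ::
    "(real^'n::finite) set \<Rightarrow> real \<Rightarrow> ((real^'n \<Rightarrow> complex) \<Rightarrow> real^'n \<Rightarrow> complex) \<Rightarrow> complex \<Rightarrow> real
      \<Rightarrow> (real^'n \<Rightarrow> complex) \<Rightarrow> real^'n \<Rightarrow> complex" where
  "spectral_projection B k T z0 r f = (SOME p. p \<in> H1 B \<and> (\<forall>v\<in>H1 B.
     H1_inner B k p v =
       contour_integral (circlepath z0 r) (\<lambda>z. H1_inner B k (H1_resolvent B T z f) v)
         / (2 * of_real pi * \<i>)))"

definition one_dimensional_range ::
    "(real^'n::finite) set \<Rightarrow> ((real^'n \<Rightarrow> complex) \<Rightarrow> real^'n \<Rightarrow> complex) \<Rightarrow> bool" where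
  "one_dimensional_range B P \<longleftrightarrow> (\<exists>w\<in>H1 B. \<not> ae_eq_on B w (\<lambda>_. 0) \<and>
     (\<exists>f\<in>H1 B. ae_eq_on B (P f) w) \<and>
     (\<forall>f\<in>H1 B. \<exists>c. ae_eq_on B (P f) (\<lambda>x. c * w x)))"

text \<open>
  The radius isolates \<open>1/lam\<close> from the rest of the spectrum; the projection does not depend on it.
\<close>
definition simple_stekloff_eigenvalue ::
    "(real^'n::finite) set \<Rightarrow> real \<Rightarrow> (nat \<Rightarrow> real) \<Rightarrow> (nat \<Rightarrow> real^'n \<Rightarrow> complex) \<Rightarrow> real
      \<Rightarrow> (real^'n \<Rightarrow> complex) \<Rightarrow> complex \<Rightarrow> bool" where
  "simple_stekloff_eigenvalue B k \<mu> Y \<delta> n lam \<longleftrightarrow>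
     lam \<noteq> 0 \<and> (\<exists>u. stekloff_eigenfunction B k \<mu> Y \<delta> n lam u) \<and>
     (\<exists>r>0. cball (inverse lam) r - {inverse lam} \<subseteq> H1_resolvent_set B k (T_op B k \<mu> Y \<delta> n lam) \<and>
        one_dimensional_range B
          (spectral_projection B k (T_op B k \<mu> Y \<delta> n lam) (inverse lam) r))"

end

theory Submission
  imports Defs
begin

text \<open>
  The expansion reduces the claim to two estimates for the perturbation \<open>q = n\<^sub>h - n\<^sub>0\<close>, which vanishes in
  \<open>B\<close> outside the closure of \<open>D\<close>: the first-order term, a constant multiple of \<open>(q u0, u0)\<close>, and the
  square of the \<open>L\<^bsup>6/5\<^esup>\<close> norm of \<open>q\<close> must both be bounded by the \<open>L\<^sup>1\<close> norm of \<open>q\<close>.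

  The remainder is a matter of interpolation (\<open>Lp_norm_interpolation\<close>): the square of the norm is at most
  the product of the \<open>L\<^sup>1\<close> norm and the \<open>L\<^bsup>3/2\<^esup>\<close> norm, and the latter tends to zero.

  The first-order term needs \<open>u0\<close> to be bounded on the closure of \<open>D\<close>, a compact subset of \<open>B\<close>. This is
  interior regularity for \<open>\<Delta>u = - k\<^sup>2 n\<^sub>0 u\<close> with square integrable right-hand side
  (\<open>weak_helmholtz_bounded_on_compact\<close>), and in dimensions two and three it holds because the fundamental
  solution of the Laplacian is locally square integrable. Multiply \<open>u\<close> by a bump function \<open>\<zeta>\<close>. Testing with
  \<open>\<zeta>\<close> times a smooth \<open>G\<close> shows that the integral of \<open>u \<zeta>
  \<Delta>G\<close> equals that of \<open>F G\<close>, where the square integrable \<open>F\<close> is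
  independent of \<open>G\<close> (\<open>weak_helmholtz_localized\<close>). For \<open>G\<close> take
  the fundamental solution with pole \<open>x\<close>, regularised by replacing \<open>|y -
  x|\<^sup>2\<close> with \<open>|y - x|\<^sup>2 + \<epsilon>\<^sup>2\<close>. The left side is then a
  mollification of \<open>\<zeta> u\<close> at \<open>x\<close> with an approximate identity, and the
  right side is bounded uniformly in \<open>x\<close> and \<open>\<epsilon>\<close>
  (\<open>mollified_solution_bound\<close>). Uniformly bounded mollifications force \<open>\<zeta>
  u\<close> to be essentially bounded; this last step goes by duality with continuous functions and inner
  regularity (\<open>AE_le_of_mollified_bound\<close>).
\<close>

section \<open>Calculus of smooth functions\<close>

lemma partial_deriv_eq:
  assumes "(f has_derivative f') (at x)"
  shows "partial_deriv i f x = f' (axis i 1)"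
  using frechet_derivative_at[OF assms] unfolding partial_deriv_def by simp

lemma continuously_differentiable_SucD:
  "continuously_differentiable (Suc m) f \<Longrightarrow> continuously_differentiable m f"
proof (induction m arbitrary: f)
  case 0
  then show ?case
    by (auto intro!: continuous_at_imp_continuous_on differentiable_imp_continuous_within)
next
  case (Suc m)
  have "continuously_differentiable m (partial_deriv i f)" for i
    using Suc.IH Suc.prems by simp
  then show ?case using Suc.prems by simp
qed

lemma continuously_differentiable_const: "continuously_differentiable m (\<lambda>_::real^'n::finite. c)"
proof (induction m arbitrary: c)
  case (Suc m)
  have "partial_deriv i (\<lambda>_::real^'n. c) = (\<lambda>_. 0)" for i
    by (rule ext, subst partial_deriv_eq[OF has_derivative_const]) simp
  then show ?case using Suc by simp
qed (simp add: continuous_on_const)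

lemma partial_deriv_mult:
  fixes f g :: "real^'n::finite \<Rightarrow> real"
  assumes "f differentiable (at x)" "g differentiable (at x)"
  shows "partial_deriv i (\<lambda>y. f y * g y) x = f x * partial_deriv i g x + partial_deriv i f x * g x"
  by (subst partial_deriv_eq[OF has_derivative_mult[OF assms(1)[unfolded frechet_derivative_works]
        assms(2)[unfolded frechet_derivative_works]]]) (simp add: partial_deriv_def)

lemma partial_deriv_add:
  assumes "f differentiable (at x)" "g differentiable (at x)"
  shows "partial_deriv i (\<lambda>y. f y + g y) x = partial_deriv i f x + partial_deriv i g x"
  by (subst partial_deriv_eq[OF has_derivative_add[OF assms(1)[unfolded frechet_derivative_works]
        assms(2)[unfolded frechet_derivative_works]]]) (simp add: partial_deriv_def)

lemma partial_deriv_chain: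
  fixes s :: "real^'n::finite \<Rightarrow> real"
  assumes "(h has_real_derivative h') (at (s x))" "s differentiable (at x)"
  shows "partial_deriv i (\<lambda>y. h (s y)) x = h' * partial_deriv i s x"
proof -
  have "(h has_derivative (*) h') (at (s x))"
    using assms(1) by (simp add: has_field_derivative_def)
  from has_derivative_compose[OF assms(2)[unfolded frechet_derivative_works] this]
  show ?thesis by (subst partial_deriv_eq) (simp_all add: partial_deriv_def)
qed

lemma partial_deriv_of_real:
  fixes f :: "real^'n::finite \<Rightarrow> real"
  assumes "f differentiable (at x)"
  shows "partial_deriv i (\<lambda>y. complex_of_real (f y)) x = of_real (partial_deriv i f x)"
  by (subst partial_deriv_eq[OF has_derivative_of_real[OF assms[unfolded frechet_derivative_works]]])
    (simp add: partial_deriv_def)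

lemma continuously_differentiable_add:
  assumes "continuously_differentiable m f" "continuously_differentiable m g"
  shows "continuously_differentiable m (\<lambda>x. f x + g x)"
  using assms
proof (induction m arbitrary: f g)
  case (Suc m)
  have "partial_deriv i (\<lambda>y. f y + g y) = (\<lambda>x. partial_deriv i f x + partial_deriv i g x)" for i
    using Suc.prems by (auto simp: partial_deriv_add)
  then show ?case using Suc by simp
qed (simp add: continuous_on_add)

lemma continuously_differentiable_mult:
  fixes f g :: "real^'n::finite \<Rightarrow> real"
  assumes "continuously_differentiable m f" "continuously_differentiable m g"
  shows "continuously_differentiable m (\<lambda>x. f x * g x)"
  using assms
proof (induction m arbitrary: f g)
  case (Suc m)
  have "partial_deriv i (\<lambda>y. f y * g y) = (\<lambda>x. f x * partial_deriv i g x + partial_deriv i f x * g x)" for i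
    using Suc.prems by (auto simp: partial_deriv_mult)
  moreover have "continuously_differentiable m f" "continuously_differentiable m g"
    using Suc.prems by (auto dest: continuously_differentiable_SucD simp del: continuously_differentiable.simps)
  ultimately show ?case using Suc by (simp add: continuously_differentiable_add)
qed (simp add: continuous_on_mult)

text \<open>
  The derivative of \<open>h \<circ> s\<close> contains \<open>h' \<circ> s\<close>, so an induction on the order of differentiability must treat
  all derivatives of \<open>h\<close> at once. Hence the outer functions range over a family \<open>H\<close> that is closed under
  differentiation along the values of \<open>s\<close>.
\<close>
lemma continuously_differentiable_chain:
  fixes s :: "real^'n::finite \<Rightarrow> real"
  assumes deriv: "\<And>h. h \<in> H \<Longrightarrow> \<exists>h'\<in>H. \<forall>x. (h has_real_derivative h' (s x)) (at (s x))"
    and "continuously_differentiable m s" "h \<in> H"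
  shows "continuously_differentiable m (\<lambda>x. h (s x))"
  using assms(2,3)
proof (induction m arbitrary: h)
  case 0
  obtain h' where "\<forall>x. (h has_real_derivative h' (s x)) (at (s x))"
    using deriv[OF 0(2)] by blast
  then have "isCont h (s x)" for x
    using DERIV_isCont by blast
  moreover have "continuous (at x) s" for x
    using 0 by (simp add: continuous_on_eq_continuous_at)
  ultimately show ?case
    by (auto intro!: continuous_at_imp_continuous_on isCont_o2[where g=h and f=s])
next
  case (Suc m)
  obtain h' where h': "h' \<in> H" "\<And>x. (h has_real_derivative h' (s x)) (at (s x))"
    using deriv[OF Suc.prems(2)] by blast
  have s: "s differentiable (at x)" for x using Suc.prems by simp
  have "partial_deriv i (\<lambda>y. h (s y)) = (\<lambda>x. h' (s x) * partial_deriv i s x)" for i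
    using partial_deriv_chain[OF h'(2) s] by blast
  moreover have "(\<lambda>y. h (s y)) differentiable (at x)" for x
    using has_derivative_compose[OF s[unfolded frechet_derivative_works] h'(2)[unfolded has_field_derivative_def]]
    by (rule differentiableI)
  moreover have "continuously_differentiable m (\<lambda>x. h' (s x))"
    using Suc.IH[OF _ h'(1)] Suc.prems(1) continuously_differentiable_SucD by blast
  ultimately show ?case
    using Suc.prems by (simp add: continuously_differentiable_mult)
qed

lemma continuously_differentiable_of_real:
  fixes f :: "real^'n::finite \<Rightarrow> real"
  assumes "continuously_differentiable m f"
  shows "continuously_differentiable m (\<lambda>x. complex_of_real (f x))"
  using assms
proof (induction m arbitrary: f)
  case (Suc m)
  have "partial_deriv i (\<lambda>y. complex_of_real (f y)) = (\<lambda>x. of_real (partial_deriv i f x))" for i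
    using Suc.prems by (auto simp: partial_deriv_of_real)
  moreover have "(\<lambda>y. complex_of_real (f y)) differentiable (at x)" for x
    using Suc.prems has_derivative_of_real differentiable_def by (metis continuously_differentiable.simps(2))
  ultimately show ?case using Suc by simp
qed (simp add: continuous_on_of_real)

lemma smooth_differentiable: "smooth f \<Longrightarrow> f differentiable (at x)"
  using continuously_differentiable.simps(2) unfolding smooth_def by blast

lemma smooth_partial_deriv: "smooth f \<Longrightarrow> smooth (partial_deriv i f)"
  using continuously_differentiable.simps(2) unfolding smooth_def by blast

lemma smooth_continuous_on: "smooth f \<Longrightarrow> continuous_on S f"
  unfolding smooth_def using continuously_differentiable.simps(1) continuous_on_subset by blast

lemma smooth_mult:
  fixes f g :: "real^'n::finite \<Rightarrow> real"
  shows "smooth f \<Longrightarrow> smooth g \<Longrightarrow> smooth (\<lambda>x. f x * g x)"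
  by (simp add: smooth_def continuously_differentiable_mult)

lemma smooth_of_real:
  fixes f :: "real^'n::finite \<Rightarrow> real"
  shows "smooth f \<Longrightarrow> smooth (\<lambda>x. complex_of_real (f x))"
  by (simp add: smooth_def continuously_differentiable_of_real)

lemma smooth_chain:
  fixes s :: "real^'n::finite \<Rightarrow> real"
  assumes "\<And>h. h \<in> H \<Longrightarrow> \<exists>h'\<in>H. \<forall>x. (h has_real_derivative h' (s x)) (at (s x))"
    and "smooth s" "h \<in> H"
  shows "smooth (\<lambda>x. h (s x))"
  unfolding smooth_def
proof
  fix m
  show "continuously_differentiable m (\<lambda>x. h (s x))"
    by (rule continuously_differentiable_chain[of H]) (use assms in \<open>auto simp: smooth_def\<close>)
qed

lemma has_derivative_shifted_square:
  fixes x :: "real^'n::finite"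
  shows "((\<lambda>y. a * (norm (y - x))\<^sup>2 + b) has_derivative (\<lambda>v. a * (2 * ((y - x) \<bullet> v)))) (at y)"
  unfolding power2_norm_eq_inner
  by (auto intro!: derivative_eq_intros simp: inner_commute algebra_simps)

lemma partial_deriv_shifted_square:
  fixes x :: "real^'n::finite"
  shows "partial_deriv i (\<lambda>y. a * (norm (y - x))\<^sup>2 + b) y = 2 * a * (y $ i - x $ i)"
  by (subst partial_deriv_eq[OF has_derivative_shifted_square]) (simp add: inner_axis)

lemma has_derivative_affine_component:
  "((\<lambda>y::real^'n::finite. a * (y $ i) + b) has_derivative (\<lambda>v. a * (v $ i))) (at y)"
  by (auto intro!: derivative_eq_intros bounded_linear.has_derivative[OF bounded_linear_vec_nth])

lemma smooth_affine_component: "smooth (\<lambda>y::real^'n::finite. a * (y $ i) + b)"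
  unfolding smooth_def
proof
  fix m
  show "continuously_differentiable m (\<lambda>y::real^'n. a * (y $ i) + b)"
  proof (cases m)
    case (Suc l)
    have "partial_deriv j (\<lambda>y. a * y $ i + b) = (\<lambda>_. a * (axis j 1 $ i))" for j
      by (rule ext) (simp add: partial_deriv_eq[OF has_derivative_affine_component])
    moreover have "(\<lambda>y. a * y $ i + b) differentiable (at y)" for y :: "real^'n"
      using has_derivative_affine_component by (rule differentiableI)
    ultimately show ?thesis
      by (simp add: Suc continuously_differentiable_const)
  qed (auto intro!: continuous_intros)
qed

lemma smooth_shifted_square:
  fixes x :: "real^'n::finite"
  shows "smooth (\<lambda>y. a * (norm (y - x))\<^sup>2 + b)"
  unfolding smooth_def
proof
  fix m
  show "continuously_differentiable m (\<lambda>y. a * (norm (y - x))\<^sup>2 + b)"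
  proof (cases m)
    case (Suc l)
    have "partial_deriv i (\<lambda>y. a * (norm (y - x))\<^sup>2 + b) = (\<lambda>y. (2*a) * (y $ i) + (- 2 * a * x $ i))" for i
      by (rule ext, unfold partial_deriv_shifted_square) (simp add: algebra_simps)
    moreover have "(\<lambda>y. a * (norm (y - x))\<^sup>2 + b) differentiable (at y)" for y
      using has_derivative_shifted_square by (rule differentiableI)
    moreover have "continuously_differentiable l (\<lambda>y. (2*a) * (y $ i) + (- 2 * a * x $ i))" for i
      using smooth_affine_component unfolding smooth_def by blast
    ultimately show ?thesis
      by (simp add: Suc)
  qed (auto intro!: continuous_intros)
qed

section \<open>A smooth bump function\<close>

text \<open>
  The profile of the classical bump is \<open>exp (- 1/t)\<close>, the case \<open>p = 1\<close>. The polynomial factor makes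
  the family closed under differentiation, which is what the chain rule for smooth functions asks for.
\<close>
definition bump_profile :: "real poly \<Rightarrow> real \<Rightarrow> real" where
  "bump_profile p t = (if t > 0 then poly p (1/t) * exp (- (1/t)) else 0)"

lemma poly_times_exp_tendsto_0: "((\<lambda>x::real. poly p x * exp (- x)) \<longlongrightarrow> 0) at_top"
proof (induction p)
  case (pCons a p)
  have "((\<lambda>x::real. x ^ k * exp (- x)) \<longlongrightarrow> 0) at_top" for k
    using tendsto_power_div_exp_0[of k] by (simp add: exp_minus field_simps)
  then have "((\<lambda>x::real. poly p x * x ^ k * exp (- x)) \<longlongrightarrow> 0) at_top" for k
  proof (induction p arbitrary: k)
    case (pCons a p)
    show ?case
      using tendsto_add[OF tendsto_mult[OF tendsto_const[of a] pCons(3)[of k]] pCons(2)[OF pCons(3), of "Suc k"]]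
      by (simp add: algebra_simps)
  qed simp
  from this[of 1] have "((\<lambda>x::real. x * poly p x * exp (- x)) \<longlongrightarrow> 0) at_top" by (simp add: mult.commute)
  moreover have "((\<lambda>x::real. a * exp (- x)) \<longlongrightarrow> 0) at_top"
    using tendsto_mult[OF tendsto_const[of a] tendsto_power_div_exp_0[of 0]] by (simp add: exp_minus field_simps)
  ultimately show ?case
    using tendsto_add by (fastforce simp: algebra_simps)
qed simp

text \<open>
  Differentiating \<open>p(1/t) exp (- 1/t)\<close> replaces \<open>p\<close> by \<open>X\<^sup>2 (p - p')\<close>. At \<open>t = 0\<close> the right difference
  quotient is \<open>x p(x) exp (- x)\<close> with \<open>x = 1/t\<close> tending to infinity, so the exponential wins.
\<close>
lemma bump_profile_has_derivative:
  "(bump_profile p has_real_derivative bump_profile ([:0,0,1:] * (p - pderiv p)) t) (at t)"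
proof -
  consider "t > 0" | "t < 0" | "t = 0" by linarith
  then show ?thesis
  proof cases
    case 1
    have "((\<lambda>t. poly p (1/t) * exp (- (1/t))) has_real_derivative
        bump_profile ([:0,0,1:] * (p - pderiv p)) t) (at t)"
      using 1 by (auto intro!: derivative_eq_intros DERIV_chain2[OF poly_DERIV]
          simp: bump_profile_def divide_simps power2_eq_square)
        (simp add: algebra_simps)
    then show ?thesis
      by (rule has_field_derivative_transform_within_open[where S="{0<..}"])
        (use 1 in \<open>auto simp: bump_profile_def\<close>)
  next
    case 2
    have "((\<lambda>t. 0::real) has_real_derivative bump_profile ([:0,0,1:] * (p - pderiv p)) t) (at t)"
      using 2 by (simp add: bump_profile_def)
    then show ?thesis
      by (rule has_field_derivative_transform_within_open[where S="{..<0}"])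
        (use 2 in \<open>auto simp: bump_profile_def\<close>)
  next
    case 3
    have "((\<lambda>t. poly (pCons 0 p) (inverse t) * exp (- (inverse t))) \<longlongrightarrow> 0) (at_right 0)"
      by (rule filterlim_compose[OF poly_times_exp_tendsto_0 filterlim_inverse_at_top_right])
    then have r: "((\<lambda>t. bump_profile p t / t) \<longlongrightarrow> 0) (at_right 0)"
      by (rule Lim_transform_eventually)
        (auto simp: eventually_at_filter bump_profile_def field_simps)
    have l: "((\<lambda>t. bump_profile p t / t) \<longlongrightarrow> 0) (at_left 0)"
      by (rule Lim_transform_eventually[OF tendsto_const])
        (auto simp: eventually_at_filter bump_profile_def)
    have "((\<lambda>t. bump_profile p t / t) \<longlongrightarrow> 0) (at 0)"
      using l r by (simp add: filterlim_at_split)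
    then show ?thesis
      using 3 by (simp add: has_field_derivative_iff bump_profile_def)
  qed
qed

lemma smooth_bump_profile_chain:
  fixes s :: "real^'n::finite \<Rightarrow> real"
  assumes "smooth s"
  shows "smooth (\<lambda>x. bump_profile p (s x))"
  by (rule smooth_chain[of "range bump_profile"]) (use assms bump_profile_has_derivative in blast)+

text \<open>
  The function \<open>exp (- 1 / (r\<^sup>2 - |y - x0|\<^sup>2))\<close>, continued by zero. The lower bound \<open>c\<close> on the half ball is
  what turns an estimate of \<open>\<zeta> u\<close> into one of \<open>u\<close>.
\<close>
lemma exists_smooth_bump:
  fixes x0 :: "real^'n::finite"
  assumes "0 < r"
  obtains \<zeta> :: "real^'n \<Rightarrow> real" and c where "smooth \<zeta>" "\<And>y. y \<notin> cball x0 r \<Longrightarrow> \<zeta> y = 0"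
    "0 < c" "\<And>y. y \<in> ball x0 (r/2) \<Longrightarrow> c \<le> \<zeta> y"
proof
  let ?\<zeta> = "\<lambda>y. bump_profile 1 (- 1 * (norm (y - x0))\<^sup>2 + r\<^sup>2)"
  show "smooth ?\<zeta>"
    by (intro smooth_bump_profile_chain smooth_shifted_square)
  show "?\<zeta> y = 0" if "y \<notin> cball x0 r" for y
  proof -
    have "r\<^sup>2 \<le> (norm (y - x0))\<^sup>2"
      using that assms by (intro power_mono) (auto simp: dist_norm norm_minus_commute)
    then show ?thesis by (simp add: bump_profile_def)
  qed
  show "0 < exp (- (1 / (r\<^sup>2 * 3/4)))" by simp
  show "exp (- (1 / (r\<^sup>2 * 3/4))) \<le> ?\<zeta> y" if "y \<in> ball x0 (r/2)" for y
  proof -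
    have "(norm (y - x0))\<^sup>2 \<le> (r/2)\<^sup>2"
      using that by (intro power_mono) (auto simp: dist_norm norm_minus_commute)
    then have le: "r\<^sup>2 * 3/4 \<le> - 1 * (norm (y - x0))\<^sup>2 + r\<^sup>2"
      by (simp add: power_divide)
    moreover have pos: "0 < r\<^sup>2 * 3/4" using assms by simp
    ultimately have "0 < - 1 * (norm (y - x0))\<^sup>2 + r\<^sup>2"
      by linarith
    moreover from le pos have "1 / (- 1 * (norm (y - x0))\<^sup>2 + r\<^sup>2) \<le> 1 / (r\<^sup>2 * 3/4)"
      by (rule frac_le[OF zero_le_one order_refl, rotated])
    ultimately show ?thesis by (simp add: bump_profile_def)
  qed
qed

section \<open>The regularised fundamental solution\<close>

text \<open>
  The fundamental solution of the Laplacian in dimension \<open>d\<close> as a function of the squared radius \<open>t\<close>: a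
  logarithm in the plane, a multiple of \<open>t\<^bsup>1 - d/2\<^esup>\<close> otherwise. The factor is chosen such that the
  derivative is \<open>t\<^bsup>- d/2\<^esup> / 2\<close> for every \<open>d\<close>.
\<close>
definition fundamental_profile :: "real \<Rightarrow> real \<Rightarrow> real" where
  "fundamental_profile d t = (if d = 2 then ln t / 2 else t powr (1 - d/2) / (2 - d))"

text \<open>
  Shifting the squared radius by \<open>\<epsilon>\<^sup>2\<close> removes the singularity, so that products with cutoff functions are
  admissible test functions.
\<close>
definition regularized_fundamental :: "real \<Rightarrow> real^'n::finite \<Rightarrow> real^'n \<Rightarrow> real" where
  "regularized_fundamental \<epsilon> x y = fundamental_profile (real CARD('n)) ((norm (y - x))\<^sup>2 + \<epsilon>\<^sup>2)"

text \<open>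
  The Laplacian of \<^const>\<open>regularized_fundamental\<close>. It is a nonnegative approximate identity with a total
  mass that does not depend on \<open>\<epsilon>\<close>, though the mass is not normalised to one.
\<close>
definition delta_kernel :: "real \<Rightarrow> real^'n::finite \<Rightarrow> real" where
  "delta_kernel \<epsilon> z =
     real CARD('n) * \<epsilon>\<^sup>2 * ((norm z)\<^sup>2 + \<epsilon>\<^sup>2) powr (- real CARD('n) / 2 - 1)"

lemma fundamental_profile_has_derivative:
  assumes "0 < t"
  shows "(fundamental_profile d has_real_derivative (1/2) * t powr (- d/2)) (at t)"
proof (cases "d = 2")
  case True
  have "((\<lambda>t. ln t / 2) has_real_derivative (1/2) * t powr (- d/2)) (at t)"
    using assms True by (auto intro!: derivative_eq_intros simp: powr_minus field_simps)
  then show ?thesis using True by (simp add: fundamental_profile_def[abs_def])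
next
  case False
  then have "2 - d \<noteq> 0" by simp
  have "((\<lambda>t. t powr (1 - d/2)) has_real_derivative (1 - d/2) * t powr (1 - d/2 - 1)) (at t)"
    using assms by (rule has_real_derivative_powr)
  from DERIV_cdivide[OF this, of "2 - d"]
  have "((\<lambda>t. t powr (1 - d/2) / (2 - d)) has_real_derivative (1 - d/2) * t powr (1 - d/2 - 1) / (2 - d)) (at t)" .
  also have "(1 - d/2) * t powr (1 - d/2 - 1) / (2 - d) = (1/2) * t powr (- d/2)"
    using \<open>2 - d \<noteq> 0\<close> by (simp add: field_simps)
  finally show ?thesis using False by (simp add: fundamental_profile_def[abs_def])
qed

lemma smooth_powr:
  fixes s :: "real^'n::finite \<Rightarrow> real"
  assumes "smooth s" "\<And>x. 0 < s x"
  shows "smooth (\<lambda>x. s x powr a)"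
proof -
  have "\<exists>h'\<in>{\<lambda>t. c * t powr a |c a. True}. \<forall>x. (h has_real_derivative h' (s x)) (at (s x))"
    if h: "h \<in> {\<lambda>t. c * t powr a |c a. True}" for h
  proof -
    obtain c a where "h = (\<lambda>t. c * t powr a)" using h by blast
    then have "(h has_real_derivative (c * a) * s x powr (a - 1)) (at (s x))" for x
      using DERIV_cmult[OF has_real_derivative_powr[OF assms(2)[of x]], of c a] by (simp add: mult.assoc)
    then show ?thesis by (intro bexI[of _ "\<lambda>t. (c * a) * t powr (a - 1)"]) auto
  qed
  moreover have "(\<lambda>t. 1 * t powr a) \<in> {\<lambda>t. c * t powr a |c a. True}" by blast
  ultimately have "smooth (\<lambda>x. 1 * s x powr a)" by (rule smooth_chain[OF _ assms(1)])
  then show ?thesis by simp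
qed

lemma shifted_square_pos: "\<epsilon> > 0 \<Longrightarrow> 0 < (norm z)\<^sup>2 + \<epsilon>\<^sup>2" for \<epsilon> :: real
  by (simp add: add_nonneg_pos)

lemma smooth_norm_square: 
  fixes x :: "real^'n::finite"
  shows "smooth (\<lambda>y. (norm (y - x))\<^sup>2 + b)"
  using smooth_shifted_square[of 1 x b] by simp

lemma partial_deriv_norm_square: 
  fixes x :: "real^'n::finite"
  shows "partial_deriv i (\<lambda>y. (norm (y - x))\<^sup>2 + b) y = 2 * (y $ i - x $ i)"
  using partial_deriv_shifted_square[of i 1 x b y] by simp

lemma partial_deriv_regularized_fundamental:
  fixes x :: "real^'n::finite"
  assumes "\<epsilon> > 0"
  shows "partial_deriv i (regularized_fundamental \<epsilon> x) =
    (\<lambda>y. (1 * y $ i + - x $ i) * ((norm (y - x))\<^sup>2 + \<epsilon>\<^sup>2) powr (- real CARD('n) / 2))"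
proof
  fix y
  show "partial_deriv i (regularized_fundamental \<epsilon> x) y =
    (1 * y $ i + - x $ i) * ((norm (y - x))\<^sup>2 + \<epsilon>\<^sup>2) powr (- real CARD('n) / 2)"
    unfolding regularized_fundamental_def[abs_def]
    by (subst partial_deriv_chain[OF fundamental_profile_has_derivative[OF shifted_square_pos[OF assms]]
          smooth_differentiable[OF smooth_norm_square]])
      (simp add: partial_deriv_norm_square)
qed

lemma differentiable_regularized_fundamental:
  fixes x :: "real^'n::finite"
  assumes "\<epsilon> > 0"
  shows "regularized_fundamental \<epsilon> x differentiable (at y)"
  unfolding regularized_fundamental_def[abs_def]
  by (rule differentiableI, rule has_derivative_compose)
    (use smooth_differentiable[OF smooth_norm_square] fundamental_profile_has_derivative[OF shifted_square_pos[OF assms]]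
      in \<open>auto simp: frechet_derivative_works has_field_derivative_def\<close>)

lemma smooth_regularized_fundamental:
  fixes x :: "real^'n::finite"
  assumes "\<epsilon> > 0"
  shows "smooth (regularized_fundamental \<epsilon> x)"
proof -
  have "smooth (partial_deriv i (regularized_fundamental \<epsilon> x))" for i
    unfolding partial_deriv_regularized_fundamental[OF assms]
    by (intro smooth_mult smooth_affine_component smooth_powr smooth_norm_square shifted_square_pos assms)
  then have "continuously_differentiable (Suc m) (regularized_fundamental \<epsilon> x)" for m
    using differentiable_regularized_fundamental[OF assms, of x] by (simp add: smooth_def)
  then show ?thesis
    unfolding smooth_def using continuously_differentiable_SucD by blast
qed

text \<open>
  With \<open>s = |y - x|\<^sup>2 + \<epsilon>\<^sup>2\<close> the Laplacian is \<open>d s\<^bsup>- d/2\<^esup> - d |y - x|\<^sup>2 s\<^bsup>- d/2 - 1\<^esup>\<close>. The two terms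
  cancel up to the factor \<open>s - |y - x|\<^sup>2 = \<epsilon>\<^sup>2\<close>.
\<close>
lemma laplacian_regularized_fundamental:
  fixes x :: "real^'n::finite"
  assumes "\<epsilon> > 0"
  shows "(\<Sum>i\<in>UNIV. partial_deriv i (partial_deriv i (regularized_fundamental \<epsilon> x)) y) = delta_kernel \<epsilon> (y - x)"
proof -
  let ?d = "real CARD('n)" and ?s = "(norm (y - x))\<^sup>2 + \<epsilon>\<^sup>2"
  have s: "0 < ?s" using shifted_square_pos[OF assms] .
  have 1: "partial_deriv i (\<lambda>y. ((norm (y - x))\<^sup>2 + \<epsilon>\<^sup>2) powr (- ?d/2)) y
      = (- ?d/2) * ?s powr (- ?d/2 - 1) * (2 * (y $ i - x $ i))" for i
    by (subst partial_deriv_chain[OF has_real_derivative_powr[OF s]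
          smooth_differentiable[OF smooth_norm_square]]) (simp add: partial_deriv_norm_square)
  have 2: "partial_deriv i (\<lambda>y. 1 * y $ i + - x $ i) y = 1" for i
    by (subst partial_deriv_eq[OF has_derivative_affine_component]) simp
  have alg: "(1 * a + - b) * ((- d/2) * P * (2 * (a - b))) + 1 * Q = Q - d * P * (a - b)\<^sup>2"
    for a b d P Q :: real
    by (simp add: power2_eq_square field_simps)
  have "partial_deriv i (partial_deriv i (regularized_fundamental \<epsilon> x)) y
      = ?s powr (- ?d/2) - ?d * ?s powr (- ?d/2 - 1) * (y $ i - x $ i)\<^sup>2" for i
    unfolding partial_deriv_regularized_fundamental[OF assms]
    by (subst partial_deriv_mult[OF smooth_differentiable[OF smooth_affine_component]
          smooth_differentiable[OF smooth_powr[OF smooth_norm_square shifted_square_pos[OF assms]]]],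
        subst 1, subst 2) (rule alg)
  then have "(\<Sum>i\<in>UNIV. partial_deriv i (partial_deriv i (regularized_fundamental \<epsilon> x)) y)
      = ?d * ?s powr (- ?d/2) - ?d * ?s powr (- ?d/2 - 1) * (\<Sum>i\<in>UNIV. (y $ i - x $ i)\<^sup>2)"
    by (simp add: sum_subtractf sum_distrib_left)
  also have "(\<Sum>i\<in>UNIV. (y $ i - x $ i)\<^sup>2) = (norm (y - x))\<^sup>2"
    by (simp add: norm_vec_def L2_set_def sum_nonneg)
  also have "?s powr (- ?d/2) = ?s powr (- ?d/2 - 1) * ?s"
    using s powr_add[of ?s "- ?d/2 - 1" 1] by simp
  finally show ?thesis by (simp add: delta_kernel_def algebra_simps)
qed

section \<open>Uniform square integrability of the fundamental solution\<close>

text \<open>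
  The weight on the right is \<open>|z|\<^bsup>- (d - 1)\<^esup>\<close> in terms of the radius. Up to dimension three it dominates the
  square of the fundamental solution: for \<open>d = 3\<close> the two are equal, and for \<open>d = 2\<close> the logarithm grows
  more slowly than \<open>t\<^bsup>- 1/4\<^esup>\<close> at zero.
\<close>
lemma fundamental_profile_square_bound:
  assumes "d = 2 \<or> d = 3" "0 < S"
  obtains C where "\<And>t. 0 < t \<Longrightarrow> t \<le> S \<Longrightarrow> (fundamental_profile d t)\<^sup>2 \<le> C * t powr (- (d - 1) / 2)"
proof (cases "d = 3")
  case True
  have "(fundamental_profile d t)\<^sup>2 \<le> 1 * t powr (- (d - 1) / 2)" if "0 < t" for t
    using that True by (simp add: fundamental_profile_def power2_eq_square flip: powr_add)
  then show ?thesis using that by blast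
next
  case False
  then have d: "d = 2" using assms by simp
  have "(fundamental_profile d t)\<^sup>2 \<le> (4 + S\<^sup>2 * S powr (1/2)) * t powr (- (d - 1) / 2)"
    if t: "0 < t" "t \<le> S" for t
  proof -
    let ?p = "t powr (- (1/2))"
    have p: "?p = (t powr (- (1/4)))\<^sup>2"
      using t by (simp add: power2_eq_square flip: powr_add)
    have S: "1 \<le> S powr (1/2) * ?p"
      using t powr_mono2[of "1/2" t S] by (simp add: powr_minus field_simps)
    have "(ln t / 2)\<^sup>2 \<le> (4 + S\<^sup>2 * S powr (1/2)) * ?p"
    proof (cases "t \<le> 1")
      case True
      have "ln (t powr (- (1/4))) \<le> t powr (- (1/4))"
        using t ln_le_minus_one[of "t powr (- (1/4))"] by simp
      then have "\<bar>ln t / 2\<bar> \<le> 2 * t powr (- (1/4))"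
        using t True by (simp add: ln_powr)
      then have "(ln t / 2)\<^sup>2 \<le> (2 * t powr (- (1/4)))\<^sup>2"
        by (rule abs_le_square_iff[THEN iffD1, OF order_trans[OF _ abs_ge_self]])
      also have "\<dots> = 4 * ?p" by (simp add: p power_mult_distrib)
      also have "\<dots> \<le> (4 + S\<^sup>2 * S powr (1/2)) * ?p"
        by (intro mult_right_mono) auto
      finally show ?thesis .
    next
      case False
      have "ln t / 2 \<le> S" "0 \<le> ln t / 2"
        using False t ln_le_minus_one[of t] by auto
      then have "(ln t / 2)\<^sup>2 \<le> S\<^sup>2" by (rule power_mono)
      also have "\<dots> \<le> S\<^sup>2 * (S powr (1/2) * ?p)"
        using mult_left_mono[OF S, of "S\<^sup>2"] by simp
      also have "\<dots> \<le> (4 + S\<^sup>2 * S powr (1/2)) * ?p"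
        by (simp add: algebra_simps)
      finally show ?thesis .
    qed
    then show ?thesis using d by (simp add: fundamental_profile_def)
  qed
  then show ?thesis using that by blast
qed

lemma nn_integral_lborel_affine:
  fixes f :: "'a::euclidean_space \<Rightarrow> ennreal"
  assumes [measurable]: "f \<in> borel_measurable borel" and c: "c \<noteq> 0"
  shows "(\<integral>\<^sup>+x. f x \<partial>lborel) = ennreal (\<bar>c\<bar> ^ DIM('a)) * (\<integral>\<^sup>+x. f (t + c *\<^sub>R x) \<partial>lborel)"
  by (subst lborel_affine[OF c, of t])
     (simp add: nn_integral_density nn_integral_distr nn_integral_cmult)

lemma integral_lborel_affine:
  fixes f :: "'a::euclidean_space \<Rightarrow> real"
  assumes [measurable]: "f \<in> borel_measurable borel" and c: "c \<noteq> 0"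
  shows "(\<integral>x. f x \<partial>lborel) = \<bar>c\<bar> ^ DIM('a) * (\<integral>x. f (t + c *\<^sub>R x) \<partial>lborel)"
  by (subst lborel_affine[OF c, of t])
     (simp add: integral_density integral_distr)

text \<open>
  Let \<open>J\<close> be the integral. The part over the outer shell \<open>R/2 \<le> |z| < R\<close> is bounded by a constant \<open>A\<close> without
  any reference to \<open>\<epsilon>\<close>. The substitution \<open>z = w/2\<close> maps the part over the inner ball to at most \<open>2\<^bsup>- d\<^esup> 2\<^bsup>d - 1\<^esup> J\<close>,
  which is \<open>J/2\<close>. Since \<open>J\<close> is finite for \<open>\<epsilon> > 0\<close>, the inequality \<open>J \<le> A + J/2\<close> gives \<open>J \<le> 2 A\<close>.
\<close>
lemma self_similar_weight_integral_bound:
  fixes R \<epsilon> :: real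
  assumes R: "R > 0" and \<epsilon>: "\<epsilon> > 0"
  shows "(\<integral>\<^sup>+z. indicator (ball 0 R) z * ennreal (((norm (z::real^'n::finite))\<^sup>2 + \<epsilon>\<^sup>2) powr (- (real CARD('n) - 1) / 2)) \<partial>lborel)
     \<le> ennreal (2 * (R/2) powr (- (real CARD('n) - 1)) * measure lborel (ball (0::real^'n) R))"
proof -
  let ?d = "real CARD('n)"
  define w where "w \<epsilon> = (\<lambda>z::real^'n. ((norm z)\<^sup>2 + \<epsilon>\<^sup>2) powr (- (?d - 1) / 2))" for \<epsilon>
  define J where "J = (\<integral>\<^sup>+z. indicator (ball 0 R) z * ennreal (w \<epsilon> z) \<partial>lborel)"
  define A where "A = (R/2) powr (- (?d - 1)) * measure lborel (ball (0::real^'n) R)"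
  have [measurable]: "w \<epsilon> \<in> borel_measurable borel" for \<epsilon> unfolding w_def by measurable
  have meas: "(\<lambda>z. indicator (ball 0 \<rho>) z * ennreal (w \<epsilon> z)) \<in> borel_measurable borel" for \<rho>
    by (intro borel_measurable_times_ennreal borel_measurable_indicator) auto
  have d: "?d \<ge> 1" by (simp add: Suc_leI)
  have fin: "emeasure lborel (ball (0::real^'n) R) < \<infinity>"
    by (rule emeasure_bounded_finite) simp
  have outer: "indicator (ball 0 R - ball 0 (R/2)) z * ennreal (w \<epsilon> z)
      \<le> ennreal ((R/2) powr (- (?d - 1))) * indicator (ball 0 R) z" for z
  proof (cases "z \<in> ball 0 R - ball 0 (R/2)")
    case True
    then have "(R/2)\<^sup>2 \<le> (norm z)\<^sup>2 + \<epsilon>\<^sup>2"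
      using R by (intro order_trans[OF power_mono[of "R/2" "norm z" 2]]) auto
    then have "w \<epsilon> z \<le> ((R/2)\<^sup>2) powr (- (?d - 1) / 2)"
      unfolding w_def using R d by (intro powr_mono2') auto
    also have "\<dots> = (R/2) powr (- (?d - 1))"
      using R by (simp add: powr_powr diff_divide_distrib flip: powr_numeral)
    finally show ?thesis using True by (simp add: ennreal_leI)
  qed (simp add: indicator_def)
  have scale: "w \<epsilon> (0 + (1/2) *\<^sub>R z) \<le> 2 powr (?d - 1) * w \<epsilon> z" for z
  proof -
    have "(1/4) * ((norm z)\<^sup>2 + \<epsilon>\<^sup>2) \<le> (norm ((1/2) *\<^sub>R z))\<^sup>2 + \<epsilon>\<^sup>2"
      by (simp add: power_mult_distrib power_divide)
    then have "w \<epsilon> (0 + (1/2) *\<^sub>R z) \<le> ((1/4) * ((norm z)\<^sup>2 + \<epsilon>\<^sup>2)) powr (- (?d - 1) / 2)"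
      unfolding w_def using shifted_square_pos[OF \<epsilon>, of z] d by (intro powr_mono2') auto
    also have "\<dots> = (1/4) powr (- (?d - 1) / 2) * w \<epsilon> z"
      unfolding w_def using shifted_square_pos[OF \<epsilon>, of z] by (simp only: powr_mult)
    also have "(1/4::real) = 2 powr (-2)" by (simp add: powr_minus)
    also have "(2 powr (-2)) powr (- (?d - 1) / 2) = 2 powr (?d - 1)"
      by (simp add: powr_powr diff_divide_distrib)
    finally show ?thesis .
  qed
  have half: "(1/2) ^ CARD('n) * 2 powr (?d - 1) = (1/2::real)"
    by (simp add: powr_diff powr_realpow power_divide)
  have "(\<integral>\<^sup>+z. indicator (ball 0 (R/2)) z * ennreal (w \<epsilon> z) \<partial>lborel)
     = ennreal ((1/2) ^ CARD('n)) *
       (\<integral>\<^sup>+z. indicator (ball 0 (R/2)) (0 + (1/2) *\<^sub>R z) * ennreal (w \<epsilon> (0 + (1/2) *\<^sub>R z)) \<partial>lborel)"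
    by (subst nn_integral_lborel_affine[where c = "1/2" and t = 0]) (simp_all add: DIM_cart meas)
  also have "\<dots> \<le> ennreal ((1/2) ^ CARD('n)) *
       (\<integral>\<^sup>+z. ennreal (2 powr (?d - 1)) * (indicator (ball 0 R) z * ennreal (w \<epsilon> z)) \<partial>lborel)"
  proof (intro mult_left_mono nn_integral_mono)
    fix z :: "real^'n"
    show "indicator (ball 0 (R/2)) (0 + (1/2) *\<^sub>R z) * ennreal (w \<epsilon> (0 + (1/2) *\<^sub>R z))
      \<le> ennreal (2 powr (?d - 1)) * (indicator (ball 0 R) z * ennreal (w \<epsilon> z))"
      using scale[of z] by (auto simp: indicator_def ennreal_leI w_def simp flip: ennreal_mult)
  qed simp
  also have "\<dots> = ennreal ((1/2) ^ CARD('n)) * (ennreal (2 powr (?d - 1)) * J)"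
          unfolding J_def by (subst nn_integral_cmult) (simp_all add: meas)
  also have "\<dots> = ennreal ((1/2) ^ CARD('n) * 2 powr (?d - 1)) * J"
    by (subst ennreal_mult) (simp_all add: mult.assoc)
  also have "\<dots> = ennreal (1/2) * J"
    by (simp only: half)
  finally have inner: "(\<integral>\<^sup>+z. indicator (ball 0 (R/2)) z * ennreal (w \<epsilon> z) \<partial>lborel) \<le> ennreal (1/2) * J" .
  have "J = (\<integral>\<^sup>+z. indicator (ball 0 R - ball 0 (R/2)) z * ennreal (w \<epsilon> z)
        + indicator (ball 0 (R/2)) z * ennreal (w \<epsilon> z) \<partial>lborel)"
    unfolding J_def using R by (intro nn_integral_cong) (auto simp: indicator_def)
  also have "\<dots> = (\<integral>\<^sup>+z. indicator (ball 0 R - ball 0 (R/2)) z * ennreal (w \<epsilon> z) \<partial>lborel)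
        + (\<integral>\<^sup>+z. indicator (ball 0 (R/2)) z * ennreal (w \<epsilon> z) \<partial>lborel)"
    by (intro nn_integral_add borel_measurable_times_ennreal borel_measurable_indicator) auto
  also have "\<dots> \<le> (\<integral>\<^sup>+z. ennreal ((R/2) powr (- (?d - 1))) * indicator (ball 0 R) (z::real^'n) \<partial>lborel)
        + ennreal (1/2) * J"
    by (intro add_mono inner nn_integral_mono outer)
  also have "(\<integral>\<^sup>+z. ennreal ((R/2) powr (- (?d - 1))) * indicator (ball 0 R) (z::real^'n) \<partial>lborel) = ennreal A"
    unfolding A_def using fin
    by (subst nn_integral_cmult_indicator) (simp_all add: ennreal_mult emeasure_eq_ennreal_measure)
  finally have ineq: "J \<le> ennreal A + ennreal (1/2) * J" .
  have "J \<le> (\<integral>\<^sup>+z. ennreal ((\<epsilon>\<^sup>2) powr (- (?d - 1) / 2)) * indicator (ball 0 R) (z::real^'n) \<partial>lborel)"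
    unfolding J_def
  proof (intro nn_integral_mono)
    fix z :: "real^'n"
    have "w \<epsilon> z \<le> (\<epsilon>\<^sup>2) powr (- (?d - 1) / 2)"
      unfolding w_def using \<epsilon> d by (intro powr_mono2') auto
    then show "indicator (ball 0 R) z * ennreal (w \<epsilon> z) \<le> ennreal ((\<epsilon>\<^sup>2) powr (- (?d - 1) / 2)) * indicator (ball 0 R) z"
      by (simp add: indicator_def ennreal_leI)
  qed
  also have "\<dots> < \<infinity>"
    using fin by (subst nn_integral_cmult_indicator) (auto simp: ennreal_mult_less_top)
  finally have "J < \<infinity>" .
  then obtain j where j: "J = ennreal j" "j \<ge> 0"
    by (cases J) auto
  have "A \<ge> 0" by (simp add: A_def)
  have "ennreal j \<le> ennreal (A + (1/2) * j)"
    using ineq j \<open>A \<ge> 0\<close> ennreal_plus[of A "(1/2) * j"] ennreal_mult[of "1/2" j] by simp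
  then have "j \<le> A + (1/2) * j" using j \<open>A \<ge> 0\<close> by (subst (asm) ennreal_le_iff) auto
  then have "J \<le> ennreal (2 * A)" using j(1) by (simp add: ennreal_leI)
  then show ?thesis
    by (simp only: J_def w_def A_def mult.assoc)
qed

text \<open>
  The fundamental solution is locally square integrable in dimensions two and three, uniformly in the
  regularisation and in the position of the pole. Two points of the ball are less than \<open>2 r\<close> apart, so one
  integral over the ball of radius \<open>2 r\<close> around the pole controls all of them.
\<close>
lemma regularized_fundamental_square_integral_bound:
  fixes x0 :: "real^'n::finite"
  assumes dim: "CARD('n) = 2 \<or> CARD('n) = 3" and r: "r > 0"
  obtains M where "M \<ge> 0" "\<And>\<epsilon> x. 0 < \<epsilon> \<Longrightarrow> \<epsilon> \<le> 1 \<Longrightarrow> x \<in> ball x0 r \<Longrightarrow>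
    (\<integral>\<^sup>+y. indicator (cball x0 r) y * ennreal ((regularized_fundamental \<epsilon> x y)\<^sup>2) \<partial>lborel) \<le> ennreal M"
proof -
  let ?d = "real CARD('n)" and ?R = "2 * r"
  have "?d = 2 \<or> ?d = 3" using dim by auto
  then obtain C where C: "\<And>t. 0 < t \<Longrightarrow> t \<le> ?R\<^sup>2 + 1 \<Longrightarrow>
      (fundamental_profile ?d t)\<^sup>2 \<le> C * t powr (- (?d - 1) / 2)"
    using fundamental_profile_square_bound[of ?d "?R\<^sup>2 + 1"] by (auto simp: add_nonneg_pos)
  have C': "(fundamental_profile ?d t)\<^sup>2 \<le> max C 0 * t powr (- (?d - 1) / 2)" if "0 < t" "t \<le> ?R\<^sup>2 + 1" for t
    using C[OF that] by (meson max.cobounded1 mult_right_mono order_trans powr_ge_zero)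
  define M where "M = max C 0 * (2 * (?R/2) powr (- (?d - 1)) * measure lborel (ball (0::real^'n) ?R))"
  show ?thesis
  proof
    show "M \<ge> 0" by (simp add: M_def)
    fix \<epsilon> :: real and x
    assume \<epsilon>: "0 < \<epsilon>" "\<epsilon> \<le> 1" and x: "x \<in> ball x0 r"
    let ?w = "\<lambda>z::real^'n. ((norm z)\<^sup>2 + \<epsilon>\<^sup>2) powr (- (?d - 1) / 2)"
    let ?f = "\<lambda>y. indicator (ball 0 ?R) (y - x) * ennreal (?w (y - x))"
    have [measurable]: "(\<lambda>y. indicator (ball 0 ?R) (y - x) :: ennreal) \<in> borel_measurable borel"
      by (rule measurable_compose[where f = "\<lambda>y. y - x" and N = borel])
        (auto intro!: borel_measurable_indicator)
    have meas: "?f \<in> borel_measurable borel"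
      by (intro borel_measurable_times_ennreal) measurable
    have "(\<integral>\<^sup>+y. indicator (cball x0 r) y * ennreal ((regularized_fundamental \<epsilon> x y)\<^sup>2) \<partial>lborel)
      \<le> (\<integral>\<^sup>+y. ennreal (max C 0) * ?f y \<partial>lborel)"
    proof (intro nn_integral_mono)
      fix y
      show "indicator (cball x0 r) y * ennreal ((regularized_fundamental \<epsilon> x y)\<^sup>2) \<le> ennreal (max C 0) * ?f y"
      proof (cases "y \<in> cball x0 r")
        case True
        then have n: "norm (y - x) < ?R"
          using x dist_triangle[of x y x0] by (simp add: dist_norm norm_minus_commute)
        then have "(norm (y - x))\<^sup>2 + \<epsilon>\<^sup>2 \<le> ?R\<^sup>2 + 1"
          using \<epsilon> by (intro add_mono power_mono power_le_one) auto
        from C'[OF shifted_square_pos[OF \<epsilon>(1)] this]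
        show ?thesis using True n
          by (simp add: regularized_fundamental_def ennreal_leI flip: ennreal_mult)
      qed simp
    qed
    also have "\<dots> = ennreal (max C 0) * (\<integral>\<^sup>+y. ?f y \<partial>lborel)"
      by (rule nn_integral_cmult) (subst measurable_cong_sets[OF sets_lborel refl], rule meas)
    also have "(\<integral>\<^sup>+y. ?f y \<partial>lborel) = (\<integral>\<^sup>+z. indicator (ball 0 ?R) z * ennreal (?w z) \<partial>lborel)"
      by (subst nn_integral_lborel_affine[OF meas, where c = 1 and t = x]) simp_all
    also have "ennreal (max C 0) * \<dots> \<le> ennreal (max C 0) * ennreal (2 * (?R/2) powr (- (?d - 1)) * measure lborel (ball (0::real^'n) ?R))"
      using r \<epsilon> by (intro mult_left_mono self_similar_weight_integral_bound) auto
    also have "\<dots> = ennreal M"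
      unfolding M_def by (rule ennreal_mult[symmetric]) auto
    finally show "(\<integral>\<^sup>+y. indicator (cball x0 r) y * ennreal ((regularized_fundamental \<epsilon> x y)\<^sup>2) \<partial>lborel) \<le> ennreal M" .
  qed
qed

section \<open>An approximate identity\<close>

lemma delta_kernel_nonneg: "delta_kernel \<epsilon> z \<ge> 0"
  by (simp add: delta_kernel_def)

text \<open>
  The kernels arise from the one with \<open>\<epsilon> = 1\<close> by the scaling that preserves the integral.
\<close>
lemma delta_kernel_scale:
  fixes z :: "real^'n::finite"
  assumes "\<epsilon> > 0"
  shows "\<epsilon> ^ CARD('n) * delta_kernel \<epsilon> (\<epsilon> *\<^sub>R z) = delta_kernel 1 z"
proof -
  let ?d = "real CARD('n)"
  have "(norm (\<epsilon> *\<^sub>R z))\<^sup>2 + \<epsilon>\<^sup>2 = \<epsilon>\<^sup>2 * ((norm z)\<^sup>2 + 1)"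
    by (simp add: power_mult_distrib algebra_simps)
  moreover have "(\<epsilon>\<^sup>2 * ((norm z)\<^sup>2 + 1)) powr (- ?d/2 - 1) = (\<epsilon>\<^sup>2) powr (- ?d/2 - 1) * ((norm z)\<^sup>2 + 1) powr (- ?d/2 - 1)"
    by (rule powr_mult)
  moreover have "(\<epsilon>\<^sup>2) powr (- ?d/2 - 1) = \<epsilon> powr (- ?d - 2)"
    using assms by (simp add: powr_powr flip: powr_numeral)
  moreover have "\<epsilon> ^ CARD('n) * (\<epsilon>\<^sup>2 * \<epsilon> powr (- ?d - 2)) = 1"
    using assms by (simp flip: powr_realpow powr_add powr_numeral)
  ultimately show ?thesis
    unfolding delta_kernel_def by (simp add: mult.assoc mult.left_commute)
qed

text \<open>
  The kernel decays like \<open>|z|\<^bsup>- d - 2\<^esup>\<close>. On the dyadic ball of radius \<open>2\<^bsup>j\<^esup>\<close>, whose volume is of order \<open>2\<^bsup>j d\<^esup>\<close>,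
  it is charged with the value \<open>a j\<close> of order \<open>4\<^bsup>- j (d/2 + 1)\<^esup>\<close>, which leaves the geometric series in \<open>1/4\<close>.
\<close>
lemma integrable_delta_kernel: "integrable lborel (delta_kernel 1 :: real^'n::finite \<Rightarrow> real)"
proof (rule integrableI_bounded)
  let ?d = "real CARD('n)"
  define p where "p = ?d/2 + 1"
  define a where "a j = 4 powr p * 4 powr (- p * real j)" for j :: nat
  have [measurable]: "(delta_kernel 1 :: real^'n \<Rightarrow> real) \<in> borel_measurable borel"
    unfolding delta_kernel_def[abs_def] by measurable
  then show "(delta_kernel 1 :: real^'n \<Rightarrow> real) \<in> borel_measurable lborel" by simp
  have pw: "ennreal (norm (delta_kernel 1 z)) \<le> ennreal ?d * (\<Sum>j. ennreal (a j) * indicator (ball 0 (2 ^ j)) z)"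
    for z :: "real^'n"
  proof -
    \<comment> \<open>Only the first dyadic ball that contains \<open>z\<close> is used in the sum.\<close>
    define j where "j = (LEAST j. norm z < 2 ^ j)"
    have ex: "\<exists>j. norm z < 2 ^ j" using real_arch_pow[of 2 "norm z"] by simp
    then have j: "norm z < 2 ^ j" unfolding j_def by (rule LeastI_ex)
    have "(1 + (norm z)\<^sup>2) powr (- p) \<le> a j"
    proof (cases j)
      case 0
      have "(1 + (norm z)\<^sup>2) powr (- p) \<le> 1"
        using powr_mono2'[of "- p" 1 "1 + (norm z)\<^sup>2"] by (simp add: p_def)
      also have "1 \<le> a j" using 0 by (simp add: a_def p_def ge_one_powr_ge_zero)
      finally show ?thesis .
    next
      case (Suc l)
      then have "2 ^ l \<le> norm z"
        using not_less_Least[of l "\<lambda>j. norm z < 2 ^ j"] by (simp add: j_def not_less)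
      then have "(2 ^ l)\<^sup>2 \<le> 1 + (norm z)\<^sup>2"
        using power_mono[of "2 ^ l" "norm z" 2] by (simp add: add_increasing)
      then have "(1 + (norm z)\<^sup>2) powr (- p) \<le> ((2 ^ l)\<^sup>2) powr (- p)"
        by (intro powr_mono2') (auto simp: p_def)
      also have "((2::real) ^ l)\<^sup>2 = 4 powr (real l)"
        by (simp add: powr_realpow power_mult[symmetric] mult.commute[of l] power_mult)
      also have "(4 powr (real l)) powr (- p) = a j"
        by (simp add: a_def powr_powr Suc algebra_simps flip: powr_add)
      finally show ?thesis .
    qed
    then have "norm (delta_kernel 1 z) \<le> ?d * a j"
    proof -
      have "- ?d / 2 - 1 = - p" by (simp add: p_def)
      then have "norm (delta_kernel 1 z) = ?d * (1 + (norm z)\<^sup>2) powr (- p)"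
        unfolding delta_kernel_def by (simp only: add.commute) simp
      then show ?thesis using \<open>(1 + (norm z)\<^sup>2) powr (- p) \<le> a j\<close> by simp
    qed
    then have "ennreal (norm (delta_kernel 1 z)) \<le> ennreal ?d * ennreal (a j)"
      by (simp add: a_def ennreal_leI flip: ennreal_mult)
    also have "ennreal (a j) = (\<Sum>i\<in>{j}. ennreal (a i) * indicator (ball 0 (2 ^ i)) z)"
      using j by simp
    also have "\<dots> \<le> (\<Sum>j. ennreal (a j) * indicator (ball 0 (2 ^ j)) z)"
      by (rule sum_le_suminf) auto
    finally show ?thesis by (simp add: mult_left_mono)
  qed
  define c where "c = measure lborel (ball (0::real^'n) 1)"
  have vol: "emeasure lborel (ball (0::real^'n) (2 ^ j)) = ennreal (2 powr (?d * real j) * c)" for j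
  proof -
    have "emeasure lborel (ball (0::real^'n) (2 ^ j)) = (\<integral>\<^sup>+z. indicator (ball (0::real^'n) (2 ^ j)) z \<partial>lborel)"
      by simp
    also have "\<dots> = ennreal ((2 ^ j) ^ CARD('n)) * (\<integral>\<^sup>+z. indicator (ball (0::real^'n) (2 ^ j)) (0 + (2 ^ j) *\<^sub>R z) \<partial>lborel)"
      by (subst nn_integral_lborel_affine[where c = "2 ^ j" and t = 0]) (simp_all add: DIM_cart borel_measurable_indicator)
    also have "(\<lambda>z. indicator (ball (0::real^'n) (2 ^ j)) (0 + (2 ^ j) *\<^sub>R z) :: ennreal) = indicator (ball 0 1)"
      by (auto simp: indicator_def fun_eq_iff)
    also have "(\<integral>\<^sup>+z. indicator (ball 0 1) (z::real^'n) \<partial>lborel) = ennreal c"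
      using emeasure_bounded_finite[of "ball (0::real^'n) 1"]
      by (simp add: c_def emeasure_eq_ennreal_measure)
    also have "((2::real) ^ j) ^ CARD('n) = 2 powr (?d * real j)"
      by (simp add: powr_realpow power_mult[symmetric] mult.commute flip: of_nat_mult)
    finally show ?thesis by (simp add: ennreal_mult c_def)
  qed
  have term_eq: "a j * (2 powr (?d * real j) * c) = (4 powr p * c) * (1/4) ^ j" for j
  proof -
    have "4 powr (- p * real j) = (2::real) powr (2 * (- p * real j))"
      using powr_powr[of 2 2 "- p * real j"] by simp
    then have "4 powr (- p * real j) * 2 powr (?d * real j) = (2::real) powr (- 2 * real j)"
      by (simp add: p_def algebra_simps flip: powr_add)
    also have "\<dots> = (1/4) ^ j"
      using powr_powr[of 2 "-2" "real j"] by (simp add: powr_realpow powr_minus)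
    finally show ?thesis by (simp add: a_def)
  qed
  have "(\<integral>\<^sup>+z. ennreal (norm (delta_kernel 1 (z::real^'n))) \<partial>lborel)
      \<le> (\<integral>\<^sup>+z. ennreal ?d * (\<Sum>j. ennreal (a j) * indicator (ball 0 (2 ^ j)) (z::real^'n)) \<partial>lborel)"
    by (intro nn_integral_mono pw)
  also have "\<dots> = ennreal ?d * (\<Sum>j. \<integral>\<^sup>+z. ennreal (a j) * indicator (ball 0 (2 ^ j)) (z::real^'n) \<partial>lborel)"
  proof -
    have m: "(\<lambda>z::real^'n. ennreal (a j) * indicator (ball 0 (2 ^ j)) z) \<in> borel_measurable lborel" for j
      by (intro borel_measurable_times_ennreal borel_measurable_const borel_measurable_indicator) auto
    show ?thesis
      unfolding nn_integral_suminf[OF m, symmetric]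
      by (rule nn_integral_cmult) (rule borel_measurable_suminf_order, rule m)
  qed
  also have "\<dots> = ennreal ?d * (\<Sum>j. ennreal ((4 powr p * c) * (1/4) ^ j))"
  proof -
    have "(\<integral>\<^sup>+z. ennreal (a j) * indicator (ball 0 (2 ^ j)) (z::real^'n) \<partial>lborel)
        = ennreal ((4 powr p * c) * (1/4) ^ j)" for j
      unfolding term_eq[symmetric]
      by (simp add: nn_integral_cmult_indicator vol a_def c_def flip: ennreal_mult)
    then show ?thesis by simp
  qed
  also have "(\<Sum>j. ennreal ((4 powr p * c) * (1/4) ^ j)) = ennreal (\<Sum>j. (4 powr p * c) * (1/4) ^ j)"
    by (rule suminf_ennreal2) (auto simp: c_def intro!: summable_mult summable_geometric)
  finally show "(\<integral>\<^sup>+z. ennreal (norm (delta_kernel 1 (z::real^'n))) \<partial>lborel) < \<infinity>"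
    by (simp add: ennreal_mult_less_top le_less_trans)
qed

lemma integral_delta_kernel_pos: "0 < (\<integral>z. delta_kernel 1 (z::real^'n::finite) \<partial>lborel)"
proof -
  have "delta_kernel 1 z > 0" for z :: "real^'n"
    by (simp add: delta_kernel_def add_nonneg_pos less_imp_neq[symmetric])
  then have "\<not> (AE z in lborel. delta_kernel 1 (z::real^'n) = 0)"
    by (simp add: less_imp_neq[symmetric] AE_iff_measurable[OF _ refl, where M=lborel])
  then have "(\<integral>z. delta_kernel 1 (z::real^'n) \<partial>lborel) \<noteq> 0"
    by (subst integral_nonneg_eq_0_iff_AE) (auto simp: integrable_delta_kernel delta_kernel_nonneg)
  moreover have "0 \<le> (\<integral>z. delta_kernel 1 (z::real^'n) \<partial>lborel)"
    by (intro Bochner_Integration.integral_nonneg delta_kernel_nonneg)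
  ultimately show ?thesis by simp
qed

text \<open>
  The substitution \<open>x = y + \<epsilon> z\<close> moves \<open>\<epsilon>\<close> from the kernel into the argument of \<open>\<psi>\<close>, so that the limit
  \<open>\<epsilon> \<rightarrow> 0\<close> is a matter of dominated convergence.
\<close>
lemma delta_kernel_convolution:
  fixes \<psi> :: "real^'n::finite \<Rightarrow> real"
  assumes "continuous_on UNIV \<psi>" "\<epsilon> > 0"
  shows "(\<integral>x. \<psi> x * delta_kernel \<epsilon> (y - x) \<partial>lborel) = (\<integral>z. \<psi> (y + \<epsilon> *\<^sub>R z) * delta_kernel 1 z \<partial>lborel)"
proof -
  have [measurable]: "\<psi> \<in> borel_measurable borel"
    using assms(1) by (rule borel_measurable_continuous_onI)
  have "(\<integral>x. \<psi> x * delta_kernel \<epsilon> (y - x) \<partial>lborel)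
    = \<bar>\<epsilon>\<bar> ^ DIM(real^'n) * (\<integral>z. \<psi> (y + \<epsilon> *\<^sub>R z) * delta_kernel \<epsilon> (y - (y + \<epsilon> *\<^sub>R z)) \<partial>lborel)"
    by (rule integral_lborel_affine) (use assms in \<open>auto simp: delta_kernel_def\<close>)
  also have "\<dots> = (\<integral>z. \<epsilon> ^ CARD('n) * (\<psi> (y + \<epsilon> *\<^sub>R z) * delta_kernel \<epsilon> (y - (y + \<epsilon> *\<^sub>R z))) \<partial>lborel)"
    using assms(2) by (simp add: DIM_cart)
  also have "\<dots> = (\<integral>z. \<psi> (y + \<epsilon> *\<^sub>R z) * delta_kernel 1 z \<partial>lborel)"
    unfolding delta_kernel_scale[OF assms(2), symmetric]
    by (intro Bochner_Integration.integral_cong) (auto simp: delta_kernel_def)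
  finally show ?thesis .
qed

lemma delta_kernel_convolution_bound:
  fixes \<psi> :: "real^'n::finite \<Rightarrow> real"
  assumes "continuous_on UNIV \<psi>" "\<And>x. \<bar>\<psi> x\<bar> \<le> b" "\<epsilon> > 0"
  shows "\<bar>\<integral>x. \<psi> x * delta_kernel \<epsilon> (y - x) \<partial>lborel\<bar> \<le> b * (\<integral>z. delta_kernel 1 (z::real^'n) \<partial>lborel)"
proof -
  have "\<bar>\<integral>x. \<psi> x * delta_kernel \<epsilon> (y - x) \<partial>lborel\<bar> \<le> (\<integral>z. b * delta_kernel 1 (z::real^'n) \<partial>lborel)"
    unfolding delta_kernel_convolution[OF assms(1,3)]
    by (rule order_trans[OF integral_abs_bound], rule integral_mono')
      (use assms order_trans[OF abs_ge_zero assms(2)] in \<open>auto simp: integrable_delta_kernel abs_mult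
        delta_kernel_nonneg intro!: mult_right_mono\<close>)
  then show ?thesis by simp
qed

lemma delta_kernel_convolution_tendsto:
  fixes \<psi> :: "real^'n::finite \<Rightarrow> real"
  assumes "continuous_on UNIV \<psi>" "\<And>x. \<bar>\<psi> x\<bar> \<le> b"
    and \<epsilon>: "\<And>j. \<epsilon> j > 0" "\<epsilon> \<longlonglongrightarrow> 0"
  shows "(\<lambda>j. \<integral>x. \<psi> x * delta_kernel (\<epsilon> j) (y - x) \<partial>lborel)
    \<longlonglongrightarrow> \<psi> y * (\<integral>z. delta_kernel 1 (z::real^'n) \<partial>lborel)"
proof -
  have [measurable]: "\<psi> \<in> borel_measurable borel"
    using assms(1) by (rule borel_measurable_continuous_onI)
  have "(\<lambda>j. \<integral>z. \<psi> (y + \<epsilon> j *\<^sub>R z) * delta_kernel 1 z \<partial>lborel) \<longlonglongrightarrow> (\<integral>z. \<psi> y * delta_kernel 1 (z::real^'n) \<partial>lborel)"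
  proof (rule integral_dominated_convergence[where w = "\<lambda>z. b * delta_kernel 1 z"])
    show "integrable lborel (\<lambda>z::real^'n. b * delta_kernel 1 z)"
      by (simp add: integrable_delta_kernel)
    show "AE z in lborel. (\<lambda>j. \<psi> (y + \<epsilon> j *\<^sub>R z) * delta_kernel 1 z) \<longlonglongrightarrow> \<psi> y * delta_kernel 1 z"
    proof (intro AE_I2 tendsto_mult tendsto_const)
      fix z :: "real^'n"
      have "(\<lambda>j. y + \<epsilon> j *\<^sub>R z) \<longlonglongrightarrow> y + 0 *\<^sub>R z"
        by (intro tendsto_intros \<epsilon>)
      then show "(\<lambda>j. \<psi> (y + \<epsilon> j *\<^sub>R z)) \<longlonglongrightarrow> \<psi> y"
        using continuous_on_tendsto_compose[OF assms(1)] by simp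
    qed
    show "AE z in lborel. norm (\<psi> (y + \<epsilon> j *\<^sub>R z) * delta_kernel 1 z) \<le> b * delta_kernel 1 z" for j
      using assms(2) by (auto simp: abs_mult delta_kernel_nonneg intro!: mult_right_mono)
  qed (auto simp: delta_kernel_def)
  then show ?thesis
    using delta_kernel_convolution[OF assms(1) \<epsilon>(1)] by simp
qed

section \<open>Pointwise bounds from bounds on mollifications\<close>

lemma finite_measure_lebesgue_on_bounded:
  fixes B :: "'a::euclidean_space set"
  assumes "open B" "bounded B"
  shows "finite_measure (lebesgue_on B)"
  using assms by (intro finite_measure_lebesgue_on) (simp add: bounded_set_imp_lmeasurable lmeasurable_open)

lemma borel_measurable_lebesgue_onI:
  "f \<in> borel_measurable borel \<Longrightarrow> f \<in> borel_measurable (lebesgue_on B)"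
  by (intro measurable_restrict_space1 measurable_completion) simp

text \<open>
  A one-sided bound for the mollifications of \<open>v\<close> on \<open>U\<close> survives the passage to the limit in duality with
  \<open>\<psi>\<close>: by Fubini the mollifier can be moved from \<open>v\<close> to \<open>\<psi>\<close>, where it converges pointwise and boundedly.
\<close>
lemma mollified_pairing_bound:
  fixes B U :: "(real^'n::finite) set" and v \<psi> :: "real^'n \<Rightarrow> real"
  assumes B: "open B" "bounded B" and U: "open U" "bounded U"
    and v: "integrable (lebesgue_on B) v"
    and mollified: "\<And>\<epsilon> x. 0 < \<epsilon> \<Longrightarrow> \<epsilon> \<le> 1 \<Longrightarrow> x \<in> U \<Longrightarrow>
        (LINT y|lebesgue_on B. v y * delta_kernel \<epsilon> (y - x)) \<le> C"
    and \<psi>: "continuous_on UNIV \<psi>" "\<And>x. 0 \<le> \<psi> x" "\<And>x. \<psi> x \<le> 1" "\<And>x. x \<notin> U \<Longrightarrow> \<psi> x = 0"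
  shows "(LINT y|lebesgue_on B. v y * \<psi> y) * (\<integral>z. delta_kernel 1 (z::real^'n) \<partial>lborel) \<le> C * (\<integral>x. \<psi> x \<partial>lborel)"
proof -
  let ?m = "\<integral>z. delta_kernel 1 (z::real^'n) \<partial>lborel"
  interpret finite_measure "lebesgue_on B" by (rule finite_measure_lebesgue_on_bounded[OF B])
  interpret pair_sigma_finite "lebesgue_on B" "lborel :: (real^'n) measure" ..
  have \<psi>_meas [measurable]: "\<psi> \<in> borel_measurable borel"
    using \<psi>(1) by (rule borel_measurable_continuous_onI)
  have v_meas [measurable]: "v \<in> borel_measurable (lebesgue_on B)" using v by auto
  have id_meas: "(\<lambda>y. y) \<in> borel_measurable (lebesgue_on B)"
    by (rule borel_measurable_lebesgue_onI) simp
  have \<psi>_abs: "\<bar>\<psi> x\<bar> \<le> 1" for x using \<psi> by auto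
  have \<psi>_int: "integrable lborel \<psi>"
  proof (rule Bochner_Integration.integrable_bound)
    show "integrable lborel (indicator U :: real^'n \<Rightarrow> real)"
      using U emeasure_bounded_finite[OF U(2)] by simp
    show "AE x in lborel. norm (\<psi> x) \<le> norm (indicator U x :: real)"
      using \<psi> by (intro AE_I2) (auto simp: indicator_def)
  qed simp
  \<comment> \<open>The constant below is the value of the kernel at the origin, its maximum.\<close>
  have conv_int: "integrable lborel (\<lambda>x. \<psi> x * delta_kernel \<epsilon> (y - x))" if "\<epsilon> > 0" for \<epsilon> and y :: "real^'n"
  proof (rule Bochner_Integration.integrable_bound)
    show "integrable lborel (\<lambda>x. (real CARD('n) * \<epsilon>\<^sup>2 * (\<epsilon>\<^sup>2) powr (- real CARD('n)/2 - 1)) * \<psi> x)"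
      using \<psi>_int by simp
    show "AE x in lborel. norm (\<psi> x * delta_kernel \<epsilon> (y - x))
        \<le> norm ((real CARD('n) * \<epsilon>\<^sup>2 * (\<epsilon>\<^sup>2) powr (- real CARD('n)/2 - 1)) * \<psi> x)"
      unfolding delta_kernel_def using that
      by (intro AE_I2) (auto simp: abs_mult mult_ac intro!: mult_left_mono powr_mono2')
  qed (auto simp: delta_kernel_def)
  have approx: "(LINT y|lebesgue_on B. v y * (\<integral>x. \<psi> x * delta_kernel \<epsilon> (y - x) \<partial>lborel)) \<le> C * (\<integral>x. \<psi> x \<partial>lborel)"
    if \<epsilon>: "0 < \<epsilon>" "\<epsilon> \<le> 1" for \<epsilon>
  proof -
    let ?f = "\<lambda>y x. v y * (\<psi> x * delta_kernel \<epsilon> (y - x))"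
    have [measurable]: "(\<lambda>(y,x). delta_kernel \<epsilon> (y - x)) \<in> borel_measurable (lebesgue_on B \<Otimes>\<^sub>M lborel)"
    proof -
      have [measurable]: "(delta_kernel \<epsilon> :: real^'n \<Rightarrow> real) \<in> borel_measurable borel"
        unfolding delta_kernel_def[abs_def] by measurable
      have "(\<lambda>p. fst p - snd p) \<in> borel_measurable (lebesgue_on B \<Otimes>\<^sub>M (lborel :: (real^'n) measure))"
        by (intro borel_measurable_diff measurable_compose[OF measurable_fst id_meas]) simp
      from measurable_compose[OF this, of "delta_kernel \<epsilon>" borel] show ?thesis
        by (simp add: case_prod_beta')
    qed
    have f_meas: "case_prod ?f \<in> borel_measurable (lebesgue_on B \<Otimes>\<^sub>M lborel)"
      by measurable
    have norm_f: "(\<integral>x. norm (?f y x) \<partial>lborel) = \<bar>v y\<bar> * (\<integral>x. \<psi> x * delta_kernel \<epsilon> (y - x) \<partial>lborel)" for y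
      using \<psi> by (simp add: abs_mult delta_kernel_nonneg)
    have f_int: "integrable (lebesgue_on B \<Otimes>\<^sub>M lborel) (case_prod ?f)"
    proof (rule Fubini_integrable[OF f_meas])
      show "integrable (lebesgue_on B) (\<lambda>y. \<integral>x. norm (case (y, x) of (y, x) \<Rightarrow> ?f y x) \<partial>lborel)"
      proof (rule Bochner_Integration.integrable_bound[of _ "\<lambda>y. ?m * v y"])
        show "integrable (lebesgue_on B) (\<lambda>y. ?m * v y)" using v by simp
        show "(\<lambda>y. \<integral>x. norm (case (y, x) of (y, x) \<Rightarrow> ?f y x) \<partial>lborel) \<in> borel_measurable (lebesgue_on B)"
          using f_meas by (intro lborel.borel_measurable_lebesgue_integral) simp
        show "AE y in lebesgue_on B. norm (\<integral>x. norm (case (y, x) of (y, x) \<Rightarrow> ?f y x) \<partial>lborel) \<le> norm (?m * v y)"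
        proof (intro AE_I2)
          fix y
          have "0 \<le> (\<integral>x. \<psi> x * delta_kernel \<epsilon> (y - x) \<partial>lborel)"
            using \<psi>(2) by (intro Bochner_Integration.integral_nonneg mult_nonneg_nonneg delta_kernel_nonneg)
          then have "\<bar>\<integral>x. \<psi> x * delta_kernel \<epsilon> (y - x) \<partial>lborel\<bar> \<le> \<bar>?m\<bar>"
            using delta_kernel_convolution_bound[OF \<psi>(1) \<psi>_abs \<epsilon>(1), of y] by simp
          then show "norm (\<integral>x. norm (case (y, x) of (y, x) \<Rightarrow> ?f y x) \<partial>lborel) \<le> norm (?m * v y)"
            unfolding prod.case norm_f unfolding real_norm_def abs_mult abs_idempotent mult.commute[of "\<bar>?m\<bar>"]
            by (rule mult_left_mono) simp
        qed
      qed
      show "AE y in lebesgue_on B. integrable lborel (\<lambda>x. case (y, x) of (y, x) \<Rightarrow> ?f y x)"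
        using conv_int[OF \<epsilon>(1)] by (intro AE_I2) simp
    qed
    have "(LINT y|lebesgue_on B. v y * (\<integral>x. \<psi> x * delta_kernel \<epsilon> (y - x) \<partial>lborel))
        = (LINT y|lebesgue_on B. (\<integral>x. ?f y x \<partial>lborel))"
      by simp
    also have "\<dots> = (\<integral>x. (LINT y|lebesgue_on B. ?f y x) \<partial>lborel)"
      by (rule Fubini_integral[OF f_int, symmetric])
    also have "\<dots> = (\<integral>x. \<psi> x * (LINT y|lebesgue_on B. v y * delta_kernel \<epsilon> (y - x)) \<partial>lborel)"
      by (simp add: mult.left_commute)
    also have "\<dots> \<le> (\<integral>x. C * \<psi> x \<partial>lborel)"
    proof (rule integral_mono)
      have "integrable lborel (\<lambda>x. (LINT y|lebesgue_on B. ?f y x))"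
        by (rule integrable_snd[OF f_int])
      then show "integrable lborel (\<lambda>x. \<psi> x * (LINT y|lebesgue_on B. v y * delta_kernel \<epsilon> (y - x)))"
        by (simp add: mult.left_commute)
      show "\<psi> x * (LINT y|lebesgue_on B. v y * delta_kernel \<epsilon> (y - x)) \<le> C * \<psi> x" for x
      proof (cases "x \<in> U")
        case True
        then show ?thesis using mult_left_mono[OF mollified[OF \<epsilon> True] \<psi>(2)[of x]] by (simp add: mult.commute)
      qed (simp add: \<psi>(4))
    qed (use \<psi>_int in simp)
    finally show ?thesis by simp
  qed
  define \<epsilon> where "\<epsilon> j = 1 / real (Suc j)" for j
  have \<epsilon>: "0 < \<epsilon> j" "\<epsilon> j \<le> 1" for j by (auto simp: \<epsilon>_def)
  have \<epsilon>_lim: "\<epsilon> \<longlonglongrightarrow> 0"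
    unfolding \<epsilon>_def using LIMSEQ_inverse_real_of_nat by (simp add: inverse_eq_divide)
  have "(\<lambda>j. LINT y|lebesgue_on B. v y * (\<integral>x. \<psi> x * delta_kernel (\<epsilon> j) (y - x) \<partial>lborel))
      \<longlonglongrightarrow> (LINT y|lebesgue_on B. v y * (\<psi> y * ?m))"
  proof (rule integral_dominated_convergence[where w = "\<lambda>y. ?m * \<bar>v y\<bar>"])
    show "integrable (lebesgue_on B) (\<lambda>y. ?m * \<bar>v y\<bar>)" using v by simp
    show "AE y in lebesgue_on B. (\<lambda>j. v y * (\<integral>x. \<psi> x * delta_kernel (\<epsilon> j) (y - x) \<partial>lborel)) \<longlonglongrightarrow> v y * (\<psi> y * ?m)"
      using delta_kernel_convolution_tendsto[OF \<psi>(1) \<psi>_abs \<epsilon>(1) \<epsilon>_lim] by (intro AE_I2 tendsto_mult tendsto_const) auto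
    show "AE y in lebesgue_on B. norm (v y * (\<integral>x. \<psi> x * delta_kernel (\<epsilon> j) (y - x) \<partial>lborel)) \<le> ?m * \<bar>v y\<bar>" for j
      using delta_kernel_convolution_bound[OF \<psi>(1) \<psi>_abs \<epsilon>(1)[of j]]
      by (intro AE_I2) (auto simp: abs_mult mult.commute[of ?m] intro!: mult_left_mono)
    show "(\<lambda>y. v y * (\<psi> y * ?m)) \<in> borel_measurable (lebesgue_on B)"
      by (intro borel_measurable_times v_meas borel_measurable_const borel_measurable_lebesgue_onI \<psi>_meas)
    show "(\<lambda>y. v y * (\<integral>x. \<psi> x * delta_kernel (\<epsilon> j) (y - x) \<partial>lborel)) \<in> borel_measurable (lebesgue_on B)" for j
      by (intro borel_measurable_times v_meas borel_measurable_lebesgue_onI lborel.borel_measurable_lebesgue_integral)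
        (simp add: delta_kernel_def)
  qed
  then have "(LINT y|lebesgue_on B. v y * (\<psi> y * ?m)) \<le> C * (\<integral>x. \<psi> x \<partial>lborel)"
    by (rule LIMSEQ_le_const2) (use approx[OF \<epsilon>] in blast)
  then show ?thesis by (simp add: mult.assoc[symmetric])
qed

text \<open>
  If \<open>v > C\<close> held on a subset of \<open>U\<close> of positive measure, then by inner regularity it would hold on a compact
  \<open>K\<close> of positive measure. The tents \<open>max 0 (1 - t dist(x, K))\<close> decrease to the indicator of \<open>K\<close>, and in the limit
  the assumption says that the integral of \<open>v - C\<close> over \<open>K\<close> is at most zero, a contradiction.
\<close>
lemma AE_le_of_tent_pairings:
  fixes B U :: "(real^'n::finite) set" and v :: "real^'n \<Rightarrow> real"
  assumes B: "open B" "bounded B" and U: "open U" "bounded U"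
    and v: "integrable (lebesgue_on B) v"
    and pairing: "\<And>\<psi>. continuous_on UNIV \<psi> \<Longrightarrow> (\<And>x. 0 \<le> \<psi> x) \<Longrightarrow> (\<And>x. \<psi> x \<le> 1) \<Longrightarrow>
        (\<And>x. x \<notin> U \<Longrightarrow> \<psi> x = 0) \<Longrightarrow> (LINT y|lebesgue_on B. v y * \<psi> y) \<le> C * (\<integral>x. \<psi> x \<partial>lborel)"
  shows "AE x in lebesgue_on B. x \<in> U \<longrightarrow> v x \<le> C"
proof -
  interpret finite_measure "lebesgue_on B" by (rule finite_measure_lebesgue_on_bounded[OF B])
  have v_meas [measurable]: "v \<in> borel_measurable (lebesgue_on B)" using v by auto
  have Bs: "B \<in> sets lebesgue" using B by simp
  define N where "N = {x \<in> B. C < v x} \<inter> U"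
  have "{x \<in> space (lebesgue_on B). C < v x} \<in> sets (lebesgue_on B)"
    by measurable
  then have Ns: "N \<in> sets lebesgue"
    unfolding N_def using Bs U(1) by (auto simp: sets_restrict_space_iff)
  have compact_null: "emeasure lebesgue K = 0" if K: "compact K" "K \<subseteq> N" for K
  proof (cases "K = {}")
    case False
    have KU: "K \<subseteq> U" "K \<subseteq> B" using K by (auto simp: N_def)
    obtain d where d: "d > 0" "\<And>x y. x \<in> K \<Longrightarrow> y \<in> - U \<Longrightarrow> d \<le> dist x y"
      using separate_compact_closed[OF K(1), of "- U"] U(1) KU(1) by (auto simp: closed_def disjoint_eq_subset_Compl)
    \<comment> \<open>The slope is at least \<open>1/d\<close> from the start, so that every tent vanishes outside \<open>U\<close>.\<close>
    define \<psi> where "\<psi> j x = max 0 (1 - (real j + 1/d) * infdist x K)" for j x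
    have \<psi>: "continuous_on UNIV (\<psi> j)" "0 \<le> \<psi> j x" "\<psi> j x \<le> 1" for j x
      using d(1) unfolding \<psi>_def by (auto intro!: continuous_intros simp: infdist_nonneg)
    have \<psi>_out: "\<psi> j x = 0" if "x \<notin> U" for j x
    proof -
      have "d \<le> infdist x K"
        unfolding infdist_notempty[OF False]
        using that d(2) False by (intro cINF_greatest) (auto simp: dist_commute)
      then have "1 \<le> (1/d) * infdist x K" using d(1) by (simp add: field_simps)
      also have "\<dots> \<le> (real j + 1/d) * infdist x K"
        by (intro mult_right_mono) (auto simp: infdist_nonneg)
      finally show ?thesis by (simp add: \<psi>_def)
    qed
    have \<psi>_lim: "(\<lambda>j. \<psi> j x) \<longlonglongrightarrow> indicator K x" for x
    proof (cases "x \<in> K")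
      case True
      then show ?thesis by (simp add: \<psi>_def)
    next
      case xK: False
      have "0 < infdist x K"
        using K(1) False xK by (simp add: compact_imp_closed infdist_pos_not_in_closed)
      then obtain J :: nat where J: "1 < real J * infdist x K"
        using reals_Archimedean3 by blast
      have "\<psi> j x = 0" if "j \<ge> J" for j
      proof -
        have "real J * infdist x K \<le> (real j + 1/d) * infdist x K"
          using that d(1) by (intro mult_right_mono) (auto simp: infdist_nonneg add_increasing2)
        then show ?thesis using J by (simp add: \<psi>_def)
      qed
      then have "eventually (\<lambda>j. \<psi> j x = indicator K x) sequentially"
        using xK by (auto simp: eventually_sequentially)
      then show ?thesis by (rule tendsto_eventually)
    qed
    have \<psi>_meas: "\<psi> j \<in> borel_measurable (lebesgue_on B)" for j
      by (intro borel_measurable_lebesgue_onI borel_measurable_continuous_onI \<psi>)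
    have Kmeas: "K \<in> sets lebesgue" "K \<in> sets borel"
      using K(1) by (auto simp: lmeasurable_compact fmeasurableD compact_imp_closed)
    have ind_meas: "(indicator K :: _ \<Rightarrow> real) \<in> borel_measurable (lebesgue_on B)"
      using Kmeas by (intro borel_measurable_lebesgue_onI borel_measurable_indicator)
    have lim1: "(\<lambda>j. LINT y|lebesgue_on B. v y * \<psi> j y) \<longlonglongrightarrow> (LINT y|lebesgue_on B. v y * indicator K y)"
    proof (rule integral_dominated_convergence[where w = "\<lambda>y. \<bar>v y\<bar>"])
      show "AE y in lebesgue_on B. (\<lambda>j. v y * \<psi> j y) \<longlonglongrightarrow> v y * indicator K y"
        by (intro AE_I2 tendsto_mult tendsto_const \<psi>_lim)
      show "AE y in lebesgue_on B. norm (v y * \<psi> j y) \<le> \<bar>v y\<bar>" for j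
        using \<psi> by (intro AE_I2) (auto simp: abs_mult mult_left_le)
    qed (use v \<psi>_meas ind_meas in auto)
    have lim2: "(\<lambda>j. \<integral>x. \<psi> j x \<partial>lborel) \<longlonglongrightarrow> (\<integral>x. indicator K x \<partial>lborel)"
    proof (rule integral_dominated_convergence[where w = "indicator U"])
      show "integrable lborel (indicator U :: real^'n \<Rightarrow> real)"
        using U emeasure_bounded_finite[OF U(2)] by simp
      show "AE x in lborel. (\<lambda>j. \<psi> j x) \<longlonglongrightarrow> indicator K x"
        by (intro AE_I2 \<psi>_lim)
      show "AE x in lborel. norm (\<psi> j x) \<le> indicator U x" for j
        using \<psi> \<psi>_out by (intro AE_I2) (auto simp: indicator_def)
      show "\<psi> j \<in> borel_measurable lborel" for j
        using borel_measurable_continuous_onI[OF \<psi>(1)] by simp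
    qed (use Kmeas in simp)
    have "(LINT y|lebesgue_on B. v y * indicator K y) \<le> C * (\<integral>x. indicator K x \<partial>lborel)"
      by (rule LIMSEQ_le[OF lim1 tendsto_mult[OF tendsto_const lim2]])
        (use pairing[OF \<psi>(1) \<psi>(2) \<psi>(3) \<psi>_out] in blast)
    also have "(\<integral>x. indicator K x \<partial>lborel) = (LINT y|lebesgue_on B. indicator K y :: real)"
    proof -
      have "(LINT y|lebesgue_on B. indicator K y :: real) = (LINT y|lebesgue. indicator K y)"
      proof -
        have "indicator B y *\<^sub>R indicator K y = (indicator K y :: real)" for y
          using KU(2) by (auto simp: indicator_def)
        moreover have "B \<inter> space lebesgue \<in> sets lebesgue" using Bs by simp
        from integral_restrict_space[OF this, of "indicator K :: _ \<Rightarrow> real"]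
        have "(LINT y|lebesgue_on B. indicator K y :: real) = (LINT y|lebesgue. indicator B y *\<^sub>R indicator K y)" .
        ultimately show ?thesis by (simp only:)
      qed
      also have "\<dots> = (\<integral>x. indicator K x \<partial>lborel)"
        using Kmeas by (intro integral_completion) simp
      finally show ?thesis by simp
    qed
    finally have le: "(LINT y|lebesgue_on B. v y * indicator K y) \<le> (LINT y|lebesgue_on B. C * indicator K y)"
      by simp
    have int1: "integrable (lebesgue_on B) (\<lambda>y. v y * indicator K y)"
      by (rule Bochner_Integration.integrable_bound[OF v borel_measurable_times[OF v_meas ind_meas]])
        (auto intro!: AE_I2 simp: indicator_def)
    have int2: "integrable (lebesgue_on B) (\<lambda>y. C * indicator K y)"
      by (rule integrable_const_bound[of _ "\<bar>C\<bar>", OF _ borel_measurable_times[OF borel_measurable_const ind_meas]])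
        (auto intro!: AE_I2 simp: indicator_def)
    have nonneg: "0 \<le> v y * indicator K y - C * indicator K y" for y
      using K(2) by (auto simp: indicator_def N_def)
    have "(LINT y|lebesgue_on B. v y * indicator K y - C * indicator K y) \<le> 0"
      using le int1 int2 by simp
    then have "(LINT y|lebesgue_on B. v y * indicator K y - C * indicator K y) = 0"
      using Bochner_Integration.integral_nonneg[of "lebesgue_on B" "\<lambda>y. v y * indicator K y - C * indicator K y"] nonneg
      by fastforce
    then have "AE y in lebesgue_on B. v y * indicator K y - C * indicator K y = 0"
      using int1 int2 nonneg by (subst (asm) integral_nonneg_eq_0_iff_AE) auto
    then have "AE y in lebesgue_on B. y \<notin> K"
      by eventually_elim (use K(2) in \<open>auto simp: N_def indicator_def split: if_splits\<close>)
    then have "AE y in lebesgue. y \<notin> K"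
      using KU(2) Bs by (auto simp: AE_restrict_space_iff)
    then show ?thesis
      using Kmeas by (simp add: AE_iff_measurable[OF _ refl])
  qed simp
  have "emeasure lebesgue N = 0"
  proof (rule ccontr)
    assume "emeasure lebesgue N \<noteq> 0"
    moreover have "N \<in> lmeasurable"
      using Ns U(2) bounded_subset[of U N] by (intro bounded_set_imp_lmeasurable) (auto simp: N_def)
    ultimately obtain e where e: "e > 0" "emeasure lebesgue N = ennreal e"
      using emeasure_eq_measure2[of N lebesgue] by (metis ennreal_0 measure_nonneg order_le_less)
    obtain T where T: "closed T" "T \<subseteq> N" "N - T \<in> lmeasurable" "emeasure lebesgue (N - T) < ennreal e"
      using sets_lebesgue_inner_closed[OF Ns e(1)] by blast
    have "compact T"
      using T U(2) by (auto simp: compact_eq_bounded_closed N_def intro: bounded_subset)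
    then have "emeasure lebesgue T = 0" using compact_null T by blast
    then have "emeasure lebesgue (N - T) = emeasure lebesgue N"
      using T(1) Ns by (intro emeasure_Diff_null_set) auto
    then show False using T(4) e by simp
  qed
  then have "AE x in lebesgue. x \<notin> N"
    using Ns by (simp add: AE_iff_measurable[OF _ refl])
  then show ?thesis
    using Bs by (auto simp: AE_restrict_space_iff N_def elim!: eventually_mono)
qed

section \<open>Products of square integrable and smooth functions\<close>

lemma L2_add:
  assumes "L2 M f" "L2 M g"
  shows "L2 M (\<lambda>x. f x + g x)"
proof -
  have "(norm (a + b))\<^sup>2 \<le> 2 * (norm a)\<^sup>2 + 2 * (norm b)\<^sup>2" for a b :: complex
  proof -
    have "(norm (a + b))\<^sup>2 \<le> (norm a + norm b)\<^sup>2"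
      by (intro power_mono norm_triangle_ineq) auto
    also have "\<dots> \<le> 2 * (norm a)\<^sup>2 + 2 * (norm b)\<^sup>2"
      using zero_le_power2[of "norm a - norm b"] by (simp add: power2_eq_square algebra_simps)
    finally show ?thesis .
  qed
  moreover have "integrable M (\<lambda>x. 2 * (norm (f x))\<^sup>2 + 2 * (norm (g x))\<^sup>2)"
    using assms by (auto simp: L2_def)
  ultimately have "integrable M (\<lambda>x. (norm (f x + g x))\<^sup>2)"
    using assms by (elim Bochner_Integration.integrable_bound) (auto simp: L2_def)
  then show ?thesis using assms by (auto simp: L2_def)
qed

lemma L2_zero: "L2 M (\<lambda>_. 0)"
  by (simp add: L2_def)

lemma L2_sum:
  assumes "finite I" "\<And>i. i \<in> I \<Longrightarrow> L2 M (f i)"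
  shows "L2 M (\<lambda>x. \<Sum>i\<in>I. f i x)"
  using assms by (induction I rule: finite_induct) (auto simp: L2_add intro: L2_zero)

lemma L2_mult_bounded:
  assumes "L2 M f" "g \<in> borel_measurable M" "AE x in M. norm (g x) \<le> C"
  shows "L2 M (\<lambda>x. f x * g x)"
proof -
  have "AE x in M. norm ((norm (f x * g x))\<^sup>2) \<le> norm (C\<^sup>2 * (norm (f x))\<^sup>2)"
    using assms(3)
  proof eventually_elim
    case (elim x)
    have "(norm (g x))\<^sup>2 \<le> C\<^sup>2" using elim by (intro power_mono) auto
    then show ?case
      by (simp add: norm_mult power_mult_distrib mult.commute[of "(norm (f x))\<^sup>2"] mult_right_mono)
  qed
  moreover have "integrable M (\<lambda>x. C\<^sup>2 * (norm (f x))\<^sup>2)" using assms by (auto simp: L2_def)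
  ultimately have "integrable M (\<lambda>x. (norm (f x * g x))\<^sup>2)"
    using assms by (elim Bochner_Integration.integrable_bound[rotated 2]) (auto simp: L2_def)
  then show ?thesis using assms by (auto simp: L2_def)
qed

lemma (in finite_measure) L2_integrable:
  assumes "L2 M f"
  shows "integrable M f"
proof (rule Bochner_Integration.integrable_bound[of M "\<lambda>x. 1 + (norm (f x))\<^sup>2"])
  have "t \<le> 1 + t\<^sup>2" for t :: real
    using zero_le_power2[of "t - 1/2"] by (simp add: power2_eq_square algebra_simps)
  then show "AE x in M. norm (f x) \<le> norm (1 + (norm (f x))\<^sup>2)"
    by (intro AE_I2) (simp add: add_nonneg_nonneg)
qed (use assms in \<open>auto simp: L2_def\<close>)

lemma smooth_bounded_on:
  assumes "smooth f" "bounded B"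
  obtains C where "\<And>x. x \<in> B \<Longrightarrow> norm (f x) \<le> C"
proof -
  have "compact (f ` closure B)"
    using assms by (intro compact_continuous_image smooth_continuous_on) auto
  then have "bounded (f ` closure B)" by (rule compact_imp_bounded)
  then obtain C where "\<forall>y \<in> f ` closure B. norm y \<le> C" unfolding bounded_iff by blast
  then show ?thesis using that closure_subset by blast
qed

lemma L2_mult_smooth:
  fixes a :: "real^'n::finite \<Rightarrow> real"
  assumes "bounded B" "L2 (lebesgue_on B) f" "smooth a"
  shows "L2 (lebesgue_on B) (\<lambda>x. f x * of_real (a x))"
proof -
  obtain C where C: "\<And>x. x \<in> B \<Longrightarrow> norm (a x) \<le> C"
    using smooth_bounded_on[OF assms(3,1)] by blast
  have "(\<lambda>x. complex_of_real (a x)) \<in> borel_measurable (lebesgue_on B)"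
    by (intro borel_measurable_lebesgue_onI borel_measurable_continuous_onI smooth_continuous_on smooth_of_real assms)
  then show ?thesis
    using C by (intro L2_mult_bounded[of _ _ _ C] assms AE_I2) auto
qed

section \<open>Interior boundedness of weak solutions\<close>

lemma partial_deriv_vanishes:
  assumes "closed K" "\<And>x. x \<notin> K \<Longrightarrow> f x = 0" "x \<notin> K"
  shows "partial_deriv i f x = 0"
proof -
  have "(f has_derivative (\<lambda>_. 0)) (at x)"
    by (rule has_derivative_transform_within_open[where f = "\<lambda>_. 0" and s = "- K"])
      (use assms in \<open>auto simp: closed_def\<close>)
  then show ?thesis by (simp add: partial_deriv_eq)
qed

lemma test_function_of_real:
  fixes a :: "real^'n::finite \<Rightarrow> real"
  assumes "smooth a" "compact K" "K \<subseteq> B" "\<And>x. x \<notin> K \<Longrightarrow> a x = 0"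
  shows "test_function B (\<lambda>x. of_real (a x))"
  unfolding test_function_def using assms smooth_of_real by (intro conjI exI[of _ K]) auto

lemma partial_deriv_of_real_mult:
  fixes a b :: "real^'n::finite \<Rightarrow> real"
  assumes "smooth a" "smooth b"
  shows "partial_deriv i (\<lambda>x. complex_of_real (a x * b x)) x
    = of_real (a x * partial_deriv i b x) + of_real (partial_deriv i a x * b x)"
  using assms
  by (subst partial_deriv_of_real) (auto simp: partial_deriv_mult smooth_differentiable smooth_mult)

text \<open>
  Distributionally \<open>\<zeta> \<Delta>u = - k\<^sup>2 q \<zeta> u\<close>, and moving the Laplacian across the cutoff \<open>\<zeta>\<close> produces only terms
  with at most one derivative of \<open>u\<close>, all of them square integrable:
  \<open>F = 2 \<nabla>u \<cdot> \<nabla>\<zeta> + u \<Delta>\<zeta> - k\<^sup>2 q u \<zeta>\<close>. The identity comes from the weak gradient tested with \<open>\<zeta> \<partial>\<^sub>iG\<close> and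
  with \<open>\<partial>\<^sub>i\<zeta> G\<close>, combined with the equation tested with \<open>\<zeta> G\<close>. No derivative falls on \<open>G\<close> in the result,
  which allows singular \<open>G\<close> in a limit.
\<close>
lemma weak_helmholtz_localized:
  fixes B :: "(real^'n::finite) set" and \<zeta> :: "real^'n \<Rightarrow> real"
  assumes B: "open B" "bounded B"
    and u: "u \<in> H1 B" "weak_helmholtz B k q u"
    and qu: "L2 (lebesgue_on B) (\<lambda>x. q x * u x)"
    and \<zeta>: "smooth \<zeta>" "compact K" "K \<subseteq> B" "\<And>x. x \<notin> K \<Longrightarrow> \<zeta> x = 0"
  obtains F where "L2 (lebesgue_on B) F" "\<And>x. x \<notin> K \<Longrightarrow> F x = 0"
    "\<And>G :: real^'n \<Rightarrow> real. smooth G \<Longrightarrow>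
      (LINT x|lebesgue_on B. u x * of_real (\<zeta> x * (\<Sum>i\<in>UNIV. partial_deriv i (partial_deriv i G) x)))
       = (LINT x|lebesgue_on B. F x * of_real (G x))"
proof -
  interpret finite_measure "lebesgue_on B" by (rule finite_measure_lebesgue_on_bounded[OF B])
  define I where "I f = (LINT x|lebesgue_on B. f x)" for f :: "real^'n \<Rightarrow> complex"
  define g where "g = weak_gradient B u"
  have "\<exists>g. is_L2_weak_gradient B u g" and u2: "L2 (lebesgue_on B) u"
    using u(1) by (auto simp: H1_def)
  then have "is_L2_weak_gradient B u g"
    unfolding g_def weak_gradient_def by (metis someI_ex)
  then have g2: "L2 (lebesgue_on B) (\<lambda>x. g x $ i)" and wg: "is_weak_gradient B u g" for i
    by (auto simp: is_L2_weak_gradient_def)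
  have K: "closed K" using \<zeta>(2) by (rule compact_imp_closed)
  let ?D = "\<lambda>i f. partial_deriv i f :: real^'n \<Rightarrow> real"
  note smooths = smooth_mult smooth_partial_deriv \<zeta>(1)
  have int: "integrable (lebesgue_on B) (\<lambda>x. f x * of_real (a x))"
    if "L2 (lebesgue_on B) f" "smooth a" for f and a :: "real^'n \<Rightarrow> real"
    by (rule L2_integrable[OF L2_mult_smooth[OF B(2) that]])
  have D\<zeta>: "?D i \<zeta> x = 0" if "x \<notin> K" for i x
    by (rule partial_deriv_vanishes[OF K \<zeta>(4) that])
  have DD\<zeta>: "?D i (?D i \<zeta>) x = 0" if "x \<notin> K" for i x
    by (rule partial_deriv_vanishes[OF K D\<zeta> that])
  have parts: "I (\<lambda>x. u x * of_real (a x * ?D i b x)) + I (\<lambda>x. u x * of_real (?D i a x * b x))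
      = - I (\<lambda>x. g x $ i * of_real (a x * b x))"
    if a: "smooth a" "\<And>x. x \<notin> K \<Longrightarrow> a x = 0" and b: "smooth b" for a b i
  proof -
    have "test_function B (\<lambda>x. of_real (a x * b x))"
      using a b \<zeta> by (intro test_function_of_real[of _ K] smooth_mult) auto
    then have "I (\<lambda>x. u x * partial_deriv i (\<lambda>x. of_real (a x * b x)) x) = - I (\<lambda>x. g x $ i * of_real (a x * b x))"
      using wg unfolding is_weak_gradient_def I_def by blast
    then show ?thesis
      unfolding partial_deriv_of_real_mult[OF a(1) b] ring_distribs I_def
      by (subst (asm) Bochner_Integration.integral_add)
        (auto intro!: int u2 smooths a b simp del: of_real_mult)
  qed
  define F where "F x = (\<Sum>i\<in>UNIV. 2 * (g x $ i * of_real (?D i \<zeta> x)))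
      + (\<Sum>i\<in>UNIV. u x * of_real (?D i (?D i \<zeta>) x)) + (- of_real (k\<^sup>2)) * (q x * u x * of_real (\<zeta> x))" for x
  have scale2: "L2 (lebesgue_on B) (\<lambda>x. c * f x)" if "L2 (lebesgue_on B) f" for c f
    using L2_mult_bounded[OF that, of "\<lambda>_. c" "norm c"] by (simp add: mult.commute)
  show ?thesis
  proof
    show "L2 (lebesgue_on B) F"
      unfolding F_def by (intro L2_add L2_sum scale2 L2_mult_smooth B g2 u2 qu smooths finite)
    show "F x = 0" if "x \<notin> K" for x
      using that by (simp add: F_def D\<zeta> DD\<zeta> \<zeta>(4))
    fix G :: "real^'n \<Rightarrow> real"
    assume G: "smooth G"
    \<comment> \<open>Only \<open>P\<close> has a derivative on \<open>G\<close>; the equation expresses the sum of all \<open>P i\<close> by the other terms.\<close>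
    define P where "P i = I (\<lambda>x. g x $ i * of_real (\<zeta> x * ?D i G x))" for i
    define Q where "Q i = I (\<lambda>x. g x $ i * of_real (?D i \<zeta> x * G x))" for i
    define R where "R i = I (\<lambda>x. u x * of_real (?D i (?D i \<zeta>) x * G x))" for i
    define H where "H = I (\<lambda>x. q x * u x * of_real (\<zeta> x * G x))"
    have 1: "I (\<lambda>x. u x * of_real (\<zeta> x * ?D i (?D i G) x)) = R i - P i + Q i" for i
    proof -
      have lin: "a = r - p + q" if "a + b = - p" "b + r = - q" for a b p q r :: complex
      proof -
        have "b = - q - r" "a = - p - b" using that by (simp_all only: eq_diff_eq)
        then show ?thesis by simp
      qed
      show ?thesis
        unfolding P_def Q_def R_def
        by (rule lin[OF parts[OF \<zeta>(1,4) smooth_partial_deriv[OF G]] parts[OF smooth_partial_deriv[OF \<zeta>(1)] D\<zeta> G]])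
    qed
    have 2: "(\<Sum>i\<in>UNIV. P i + Q i) = of_real (k\<^sup>2) * H"
    proof -
      let ?\<phi> = "\<lambda>x. complex_of_real (\<zeta> x * G x)"
      have "test_function B ?\<phi>"
        using \<zeta> G by (intro test_function_of_real[of _ K] smooth_mult) auto
      then have "L2_inner_vec (lebesgue_on B) g (gradient ?\<phi>)
          = of_real (k\<^sup>2) * L2_inner (lebesgue_on B) (\<lambda>x. q x * u x) ?\<phi>"
        using u(2) unfolding weak_helmholtz_def g_def by blast
      moreover have "L2_inner (lebesgue_on B) (\<lambda>x. q x * u x) ?\<phi> = H"
        by (simp add: L2_inner_def H_def I_def)
      moreover have "L2_inner_vec (lebesgue_on B) g (gradient ?\<phi>) = (\<Sum>i\<in>UNIV. P i + Q i)"
      proof -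
        have "L2_inner_vec (lebesgue_on B) g (gradient ?\<phi>)
          = I (\<lambda>x. \<Sum>i\<in>UNIV. g x $ i * of_real (\<zeta> x * ?D i G x) + g x $ i * of_real (?D i \<zeta> x * G x))"
          unfolding L2_inner_vec_def I_def gradient_def vec_lambda_beta partial_deriv_of_real_mult[OF \<zeta>(1) G]
          by (simp add: ring_distribs)
        also have "\<dots> = (\<Sum>i\<in>UNIV. I (\<lambda>x. g x $ i * of_real (\<zeta> x * ?D i G x) + g x $ i * of_real (?D i \<zeta> x * G x)))"
          unfolding I_def
          by (intro Bochner_Integration.integral_sum Bochner_Integration.integrable_add int g2 smooths G)
        also have "\<dots> = (\<Sum>i\<in>UNIV. P i + Q i)"
          unfolding I_def P_def Q_def
          by (intro sum.cong Bochner_Integration.integral_add int g2 smooths G refl)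
        finally show ?thesis .
      qed
      ultimately show ?thesis by simp
    qed
    have "(LINT x|lebesgue_on B. u x * of_real (\<zeta> x * (\<Sum>i\<in>UNIV. ?D i (?D i G) x)))
        = I (\<lambda>x. \<Sum>i\<in>UNIV. u x * of_real (\<zeta> x * ?D i (?D i G) x))"
      by (simp add: I_def sum_distrib_left)
    also have "\<dots> = (\<Sum>i\<in>UNIV. I (\<lambda>x. u x * of_real (\<zeta> x * ?D i (?D i G) x)))"
      unfolding I_def by (intro Bochner_Integration.integral_sum int u2 smooths G)
    also have "\<dots> = (\<Sum>i\<in>UNIV. R i) + 2 * (\<Sum>i\<in>UNIV. Q i) - (\<Sum>i\<in>UNIV. P i + Q i)"
      unfolding 1 by (simp add: sum.distrib sum_subtractf)
    also have "\<dots> = (\<Sum>i\<in>UNIV. 2 * Q i) + (\<Sum>i\<in>UNIV. R i) + (- of_real (k\<^sup>2)) * H"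
      unfolding 2 by (simp add: sum_distrib_left)
    also have "\<dots> = I (\<lambda>x. (\<Sum>i\<in>UNIV. 2 * (g x $ i * of_real (?D i \<zeta> x * G x)))
        + (\<Sum>i\<in>UNIV. u x * of_real (?D i (?D i \<zeta>) x * G x)) + (- of_real (k\<^sup>2)) * (q x * u x * of_real (\<zeta> x * G x)))"
    proof -
      have i1: "integrable (lebesgue_on B) (\<lambda>x. 2 * (g x $ i * of_real (?D i \<zeta> x * G x)))"
        and i2: "integrable (lebesgue_on B) (\<lambda>x. u x * of_real (?D i (?D i \<zeta>) x * G x))"
        and i3: "integrable (lebesgue_on B) (\<lambda>x. (- of_real (k\<^sup>2)) * (q x * u x * of_real (\<zeta> x * G x)))" for i
        by (intro integrable_mult_right int g2 u2 qu smooths G)+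
      show ?thesis
        unfolding I_def Q_def R_def H_def
        using i1 i2 i3 by (simp add: Bochner_Integration.integral_add Bochner_Integration.integral_sum)
    qed
    also have "\<dots> = (LINT x|lebesgue_on B. F x * of_real (G x))"
      unfolding I_def F_def
      by (intro Bochner_Integration.integral_cong refl) (simp add: ring_distribs sum_distrib_right mult.assoc)
    finally show "(LINT x|lebesgue_on B. u x * of_real (\<zeta> x * (\<Sum>i\<in>UNIV. ?D i (?D i G) x)))
       = (LINT x|lebesgue_on B. F x * of_real (G x))" .
  qed
qed

text \<open>
  Choosing the regularised fundamental solution with pole \<open>x\<close> as \<open>G\<close> turns the localised identity into a
  representation of the mollification of \<open>\<zeta> u\<close> at \<open>x\<close> as an integral of \<open>F G\<close>. On the ball both factors
  are square integrable, uniformly in \<open>\<epsilon>\<close> and \<open>x\<close>, so \<open>|F G| \<le> |F|\<^sup>2 + |G|\<^sup>2\<close> bounds it.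
\<close>
lemma mollified_solution_bound:
  fixes B :: "(real^'n::finite) set" and \<zeta> :: "real^'n \<Rightarrow> real"
  assumes dim: "CARD('n) = 2 \<or> CARD('n) = 3"
    and B: "open B" "bounded B"
    and u: "u \<in> H1 B" "weak_helmholtz B k q u"
    and qu: "L2 (lebesgue_on B) (\<lambda>x. q x * u x)"
    and r: "r > 0" "cball x0 r \<subseteq> B"
    and \<zeta>: "smooth \<zeta>" "\<And>x. x \<notin> cball x0 r \<Longrightarrow> \<zeta> x = 0"
  obtains C where "\<And>\<epsilon> x. 0 < \<epsilon> \<Longrightarrow> \<epsilon> \<le> 1 \<Longrightarrow> x \<in> ball x0 r \<Longrightarrow>
    norm (LINT y|lebesgue_on B. (u y * of_real (\<zeta> y)) * of_real (delta_kernel \<epsilon> (y - x))) \<le> C"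
proof -
  let ?K = "cball x0 r"
  interpret finite_measure "lebesgue_on B" by (rule finite_measure_lebesgue_on_bounded[OF B])
  obtain F where F: "L2 (lebesgue_on B) F" "\<And>x. x \<notin> ?K \<Longrightarrow> F x = 0"
    and eq: "\<And>G :: real^'n \<Rightarrow> real. smooth G \<Longrightarrow>
      (LINT x|lebesgue_on B. u x * of_real (\<zeta> x * (\<Sum>i\<in>UNIV. partial_deriv i (partial_deriv i G) x)))
       = (LINT x|lebesgue_on B. F x * of_real (G x))"
    using weak_helmholtz_localized[OF B u qu \<zeta>(1) compact_cball r(2) \<zeta>(2)] by blast
  obtain M where M: "M \<ge> 0" "\<And>\<epsilon> x. 0 < \<epsilon> \<Longrightarrow> \<epsilon> \<le> 1 \<Longrightarrow> x \<in> ball x0 r \<Longrightarrow>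
    (\<integral>\<^sup>+y. indicator ?K y * ennreal ((regularized_fundamental \<epsilon> x y)\<^sup>2) \<partial>lborel) \<le> ennreal M"
    using regularized_fundamental_square_integral_bound[OF dim r(1)] by blast
  define A where "A = (LINT y|lebesgue_on B. (norm (F y))\<^sup>2)"
  have "norm (LINT y|lebesgue_on B. (u y * of_real (\<zeta> y)) * of_real (delta_kernel \<epsilon> (y - x))) \<le> A + M"
    if \<epsilon>: "0 < \<epsilon>" "\<epsilon> \<le> 1" and x: "x \<in> ball x0 r" for \<epsilon> x
  proof -
    let ?G = "regularized_fundamental \<epsilon> x"
    let ?H = "\<lambda>y. indicator ?K y * (?G y)\<^sup>2"
    have G: "smooth ?G" by (rule smooth_regularized_fundamental[OF \<epsilon>(1)])
    have G_meas: "?G \<in> borel_measurable borel"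
      by (intro borel_measurable_continuous_onI smooth_continuous_on G)
    have H_meas: "?H \<in> borel_measurable borel"
      using G_meas by (intro borel_measurable_times borel_measurable_power borel_measurable_indicator) auto
    have H_nn: "(\<integral>\<^sup>+y. ennreal (?H y) \<partial>lborel) \<le> ennreal M"
      using M(2)[OF \<epsilon> x] by (simp add: ennreal_mult ennreal_indicator)
    have H_int: "integrable lborel ?H"
      using H_meas H_nn by (intro integrableI_nonneg) (auto simp: le_less_trans)
    have H_M: "(LINT y|lborel. ?H y) \<le> M"
      using H_nn M(1) H_int by (subst (asm) nn_integral_eq_integral) auto
    have H_eq: "indicator B y *\<^sub>R ?H y = ?H y" for y
      using r(2) by (auto simp: indicator_def)
    have Bs: "B \<inter> space lebesgue \<in> sets lebesgue" using B by simp
    have H_leb: "integrable lebesgue ?H"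
      using H_int H_meas by (simp add: integrable_completion)
    have H_B: "integrable (lebesgue_on B) ?H"
      using H_leb unfolding integrable_restrict_space[OF Bs] H_eq .
    have "(LINT y|lebesgue_on B. ?H y) = (LINT y|lebesgue. ?H y)"
      unfolding integral_restrict_space[OF Bs] H_eq ..
    also have "\<dots> = (LINT y|lborel. ?H y)"
      using H_meas by (intro integral_completion) simp
    finally have H_le: "(LINT y|lebesgue_on B. ?H y) \<le> M" using H_M by simp
    have bound: "norm (F y * of_real (?G y)) \<le> (norm (F y))\<^sup>2 + ?H y" for y
    proof (cases "y \<in> ?K")
      case True
      have "0 \<le> (norm (F y) - \<bar>?G y\<bar>)\<^sup>2 + ((norm (F y))\<^sup>2 + \<bar>?G y\<bar>\<^sup>2)" by simp
      then have "norm (F y) * \<bar>?G y\<bar> \<le> (norm (F y))\<^sup>2 + \<bar>?G y\<bar>\<^sup>2"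
        by (simp add: power2_diff)
      then show ?thesis using True by (simp add: norm_mult)
    qed (simp add: F(2))
    have F_int: "integrable (lebesgue_on B) (\<lambda>y. (norm (F y))\<^sup>2)"
      using F(1) by (simp add: L2_def)
    have "(LINT y|lebesgue_on B. (u y * of_real (\<zeta> y)) * of_real (delta_kernel \<epsilon> (y - x)))
        = (LINT y|lebesgue_on B. F y * of_real (?G y))"
      using eq[OF G] unfolding laplacian_regularized_fundamental[OF \<epsilon>(1)] by (simp add: mult.assoc)
    also have "norm \<dots> \<le> (LINT y|lebesgue_on B. norm (F y * of_real (?G y)))"
      by (rule integral_norm_bound)
    also have "\<dots> \<le> (LINT y|lebesgue_on B. (norm (F y))\<^sup>2 + ?H y)"
      by (rule integral_mono'[OF Bochner_Integration.integrable_add[OF F_int H_B] bound]) simp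
    also have "\<dots> = A + (LINT y|lebesgue_on B. ?H y)"
      unfolding A_def by (rule Bochner_Integration.integral_add[OF F_int H_B])
    also have "\<dots> \<le> A + M" using H_le by simp
    finally show ?thesis .
  qed
  then show ?thesis using that by blast
qed

lemma AE_le_of_mollified_bound:
  fixes B U :: "(real^'n::finite) set" and v :: "real^'n \<Rightarrow> real"
  assumes B: "open B" "bounded B" and U: "open U" "bounded U"
    and v: "integrable (lebesgue_on B) v"
    and mollified: "\<And>\<epsilon> x. 0 < \<epsilon> \<Longrightarrow> \<epsilon> \<le> 1 \<Longrightarrow> x \<in> U \<Longrightarrow>
        (LINT y|lebesgue_on B. v y * delta_kernel \<epsilon> (y - x)) \<le> C"
  shows "AE x in lebesgue_on B. x \<in> U \<longrightarrow> v x \<le> C / (\<integral>z. delta_kernel 1 (z::real^'n) \<partial>lborel)"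
proof (rule AE_le_of_tent_pairings[OF B U v])
  fix \<psi> :: "real^'n \<Rightarrow> real"
  assume "continuous_on UNIV \<psi>" "\<And>x. 0 \<le> \<psi> x" "\<And>x. \<psi> x \<le> 1" "\<And>x. x \<notin> U \<Longrightarrow> \<psi> x = 0"
  from mollified_pairing_bound[OF B U v mollified this]
  show "(LINT y|lebesgue_on B. v y * \<psi> y) \<le> C / (\<integral>z. delta_kernel 1 (z::real^'n) \<partial>lborel) * (\<integral>x. \<psi> x \<partial>lborel)"
    using integral_delta_kernel_pos[where 'n='n] by (simp add: field_simps)
qed

text \<open>
  The one-sided bounds are applied to the real parts of \<open>z \<zeta> u\<close> with \<open>z = 1, -1, \<i>, -\<i>\<close>, which together
  control the modulus of \<open>\<zeta> u\<close>; division by the lower bound of \<open>\<zeta>\<close> then gives \<open>u\<close>.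
\<close>
lemma weak_helmholtz_bounded_on_ball:
  fixes B :: "(real^'n::finite) set"
  assumes dim: "CARD('n) = 2 \<or> CARD('n) = 3"
    and B: "open B" "bounded B"
    and u: "u \<in> H1 B" "weak_helmholtz B k q u"
    and qu: "L2 (lebesgue_on B) (\<lambda>x. q x * u x)"
    and r: "r > 0" "cball x0 r \<subseteq> B"
  obtains M where "AE x in lebesgue_on B. x \<in> ball x0 (r/2) \<longrightarrow> norm (u x) \<le> M"
proof -
  interpret finite_measure "lebesgue_on B" by (rule finite_measure_lebesgue_on_bounded[OF B])
  obtain \<zeta> :: "real^'n \<Rightarrow> real" and c where \<zeta>: "smooth \<zeta>" "\<And>y. y \<notin> cball x0 r \<Longrightarrow> \<zeta> y = 0"
    and c: "0 < c" "\<And>y. y \<in> ball x0 (r/2) \<Longrightarrow> c \<le> \<zeta> y"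
    using exists_smooth_bump[OF r(1)] by metis
  let ?w = "\<lambda>y. u y * of_real (\<zeta> y)"
  let ?m = "\<integral>z. delta_kernel 1 (z::real^'n) \<partial>lborel"
  obtain C where C: "\<And>\<epsilon> x. 0 < \<epsilon> \<Longrightarrow> \<epsilon> \<le> 1 \<Longrightarrow> x \<in> ball x0 r \<Longrightarrow>
    norm (LINT y|lebesgue_on B. ?w y * of_real (delta_kernel \<epsilon> (y - x))) \<le> C"
    using mollified_solution_bound[OF dim B u qu r \<zeta>] by blast
  have w_L2: "L2 (lebesgue_on B) ?w"
    using u(1) by (intro L2_mult_smooth B \<zeta>(1)) (simp add: H1_def)
  have w: "integrable (lebesgue_on B) ?w" by (rule L2_integrable[OF w_L2])
  have dir: "AE x in lebesgue_on B. x \<in> ball x0 r \<longrightarrow> Re (z * ?w x) \<le> C / ?m" if z: "norm z = 1" for z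
  proof (rule AE_le_of_mollified_bound[OF B open_ball bounded_ball])
    show "integrable (lebesgue_on B) (\<lambda>x. Re (z * ?w x))"
      using w by (intro integrable_Re integrable_mult_right) simp
    fix \<epsilon> :: real and x
    assume \<epsilon>: "0 < \<epsilon>" "\<epsilon> \<le> 1" "x \<in> ball x0 r"
    have "(\<lambda>y. complex_of_real (delta_kernel \<epsilon> (y - x))) \<in> borel_measurable (lebesgue_on B)"
      unfolding delta_kernel_def by (rule borel_measurable_lebesgue_onI) measurable
    moreover have "norm (complex_of_real (delta_kernel \<epsilon> z)) \<le> real CARD('n) * \<epsilon>\<^sup>2 * (\<epsilon>\<^sup>2) powr (- real CARD('n)/2 - 1)" for z :: "real^'n"
      unfolding norm_of_real abs_of_nonneg[OF delta_kernel_nonneg]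
      unfolding delta_kernel_def using \<epsilon>(1) by (auto intro!: mult_left_mono powr_mono2')
    ultimately have int: "integrable (lebesgue_on B) (\<lambda>y. ?w y * of_real (delta_kernel \<epsilon> (y - x)))"
      by (intro L2_integrable[OF L2_mult_bounded[OF w_L2]] AE_I2)
    have "(LINT y|lebesgue_on B. Re (z * ?w y) * delta_kernel \<epsilon> (y - x))
        = (LINT y|lebesgue_on B. Re (z * (?w y * of_real (delta_kernel \<epsilon> (y - x)))))"
      by (simp add: algebra_simps)
    also have "\<dots> = Re (z * (LINT y|lebesgue_on B. ?w y * of_real (delta_kernel \<epsilon> (y - x))))"
      using int by (subst integral_Re) auto
    also have "\<dots> \<le> norm (z * (LINT y|lebesgue_on B. ?w y * of_real (delta_kernel \<epsilon> (y - x))))"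
      by (rule complex_Re_le_cmod)
    also have "\<dots> \<le> C" using C[OF \<epsilon>] z by (simp add: norm_mult)
    finally show "(LINT y|lebesgue_on B. Re (z * ?w y) * delta_kernel \<epsilon> (y - x)) \<le> C" .
  qed
  have "AE x in lebesgue_on B. x \<in> ball x0 (r/2) \<longrightarrow> norm (u x) \<le> 2 * (C / ?m) / c"
    using dir[of 1, simplified] dir[of "-1", simplified] dir[of \<i>, simplified] dir[of "-\<i>", simplified]
  proof eventually_elim
    case (elim x)
    show ?case
    proof
      assume x: "x \<in> ball x0 (r/2)"
      then have "x \<in> ball x0 r" using r by auto
      then have "\<bar>Re (?w x)\<bar> \<le> C / ?m" "\<bar>Im (?w x)\<bar> \<le> C / ?m"
        using elim by (auto simp: abs_le_iff)
      then have "norm (?w x) \<le> 2 * (C / ?m)"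
        using cmod_le[of "?w x"] by simp
      moreover have "c * norm (u x) \<le> norm (?w x)"
        using c(1) mult_left_mono[OF c(2)[OF x], of "norm (u x)"] c(2)[OF x]
        by (simp add: norm_mult mult.commute[of c])
      ultimately show "norm (u x) \<le> 2 * (C / ?m) / c"
        unfolding pos_le_divide_eq[OF c(1)] mult.commute[of "norm (u x)"] by (rule order_trans[rotated])
    qed
  qed
  then show ?thesis using that by blast
qed

text \<open>
  Interior regularity: finitely many of the balls on which \<open>u\<close> is bounded cover the compact set.
\<close>
lemma weak_helmholtz_bounded_on_compact:
  fixes B :: "(real^'n::finite) set"
  assumes dim: "CARD('n) = 2 \<or> CARD('n) = 3"
    and B: "open B" "bounded B"
    and u: "u \<in> H1 B" "weak_helmholtz B k q u"
    and qu: "L2 (lebesgue_on B) (\<lambda>x. q x * u x)"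
    and K: "compact K" "K \<subseteq> B"
  obtains M where "M \<ge> 0" "AE x in lebesgue_on B. x \<in> K \<longrightarrow> norm (u x) \<le> M"
proof -
  have "\<forall>x0\<in>K. \<exists>r M. 0 < r \<and> (AE x in lebesgue_on B. x \<in> ball x0 (r/2) \<longrightarrow> norm (u x) \<le> M)"
  proof
    fix x0 assume "x0 \<in> K"
    then obtain r where r: "r > 0" "cball x0 r \<subseteq> B"
      using B(1) K(2) open_contains_cball by blast
    then show "\<exists>r M. 0 < r \<and> (AE x in lebesgue_on B. x \<in> ball x0 (r/2) \<longrightarrow> norm (u x) \<le> M)"
      using weak_helmholtz_bounded_on_ball[OF dim B u qu r] r(1) by meson
  qed
  from bchoice[OF this] obtain r where
    "\<forall>x0\<in>K. \<exists>M. 0 < r x0 \<and> (AE x in lebesgue_on B. x \<in> ball x0 (r x0 / 2) \<longrightarrow> norm (u x) \<le> M)" ..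
  from bchoice[OF this] obtain M where
    rM: "\<forall>x0\<in>K. 0 < r x0 \<and> (AE x in lebesgue_on B. x \<in> ball x0 (r x0 / 2) \<longrightarrow> norm (u x) \<le> M x0)" ..
  then have r: "0 < r x0" and M: "AE x in lebesgue_on B. x \<in> ball x0 (r x0 / 2) \<longrightarrow> norm (u x) \<le> M x0"
    if "x0 \<in> K" for x0
    using that by auto
  have "K \<subseteq> (\<Union>x0\<in>K. ball x0 (r x0 / 2))"
  proof
    fix x assume "x \<in> K"
    then show "x \<in> (\<Union>x0\<in>K. ball x0 (r x0 / 2))" using r[of x] by (intro UN_I[of x]) simp_all
  qed
  from compactE_image[OF K(1) open_ball this] obtain I where I: "I \<subseteq> K" "finite I" "K \<subseteq> (\<Union>x0\<in>I. ball x0 (r x0 / 2))"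
    by metis
  let ?M = "\<Sum>x0\<in>I. \<bar>M x0\<bar>"
  have "AE x in lebesgue_on B. \<forall>x0\<in>I. x \<in> ball x0 (r x0 / 2) \<longrightarrow> norm (u x) \<le> M x0"
    unfolding AE_finite_all[OF I(2)] using I(1) M by blast
  then have "AE x in lebesgue_on B. x \<in> K \<longrightarrow> norm (u x) \<le> ?M"
  proof eventually_elim
    case (elim x)
    show ?case
    proof
      assume "x \<in> K"
      then obtain x0 where x0: "x0 \<in> I" "x \<in> ball x0 (r x0 / 2)" using I by blast
      then have "norm (u x) \<le> \<bar>M x0\<bar>" using elim by (meson abs_ge_self order_trans)
      also have "\<dots> \<le> ?M" using x0 I by (intro member_le_sum) auto
      finally show "norm (u x) \<le> ?M" .
    qed
  qed
  then show ?thesis using that[of ?M] by (simp add: sum_nonneg)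
qed

section \<open>Eigenvalue perturbation\<close>

lemma Lp_norm_1: "Lp_norm 1 M f = (LINT x|M. norm (f x))"
  by (simp add: Lp_norm_def)

text \<open>
  Since \<open>5/6 = (1 + 2/3)/2\<close>, the space with exponent \<open>6/5\<close> lies halfway between those with exponents \<open>1\<close> and
  \<open>3/2\<close>. The inequality follows by integrating Young's inequality for \<open>|f|\<close> and \<open>|f|\<^bsup>3/2\<^esup>\<close>, both normalised to have
  integral one.
\<close>
lemma Lp_norm_interpolation:
  fixes f :: "'a \<Rightarrow> complex"
  assumes "integrable M (\<lambda>x. norm (f x))" "integrable M (\<lambda>x. norm (f x) powr (3/2))"
  shows "(Lp_norm (6/5) M f)\<^sup>2 \<le> Lp_norm 1 M f * Lp_norm (3/2) M f"
proof -
  let ?A = "LINT x|M. norm (f x)" and ?E = "LINT x|M. norm (f x) powr (3/2)"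
  let ?J = "LINT x|M. norm (f x) powr (6/5)"
  have f_meas: "(\<lambda>x. norm (f x)) \<in> borel_measurable M" using assms(1) by auto
  have A0: "0 \<le> ?A" and E0: "0 \<le> ?E" and J0: "0 \<le> ?J"
    by (auto intro!: Bochner_Integration.integral_nonneg)
  have J: "?J \<le> ?A powr (3/5) * ?E powr (2/5)"
  proof (cases "?A = 0 \<or> ?E = 0")
    case True
    then have "AE x in M. norm (f x) powr (6/5) = 0"
    proof
      assume "?A = 0"
      then have "AE x in M. norm (f x) = 0"
        using assms(1) by (subst (asm) integral_nonneg_eq_0_iff_AE) auto
      then show ?thesis by eventually_elim simp
    next
      assume "?E = 0"
      then have "AE x in M. norm (f x) powr (3/2) = 0"
        using assms(2) by (subst (asm) integral_nonneg_eq_0_iff_AE) auto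
      then show ?thesis by eventually_elim simp
    qed
    then have "?J = 0" by (rule integral_eq_zero_AE)
    then show ?thesis by simp
  next
    case False
    then have A: "0 < ?A" and E: "0 < ?E" using A0 E0 by (auto simp: less_le)
    let ?c = "?A powr (3/5) * ?E powr (2/5)"
    have "norm (f x) powr (6/5) \<le> ?c * ((3/5) * (norm (f x) / ?A) + (2/5) * (norm (f x) powr (3/2) / ?E))" for x
    proof (cases "f x = 0")
      case False
      then have "(norm (f x) / ?A) powr (3/5) * (norm (f x) powr (3/2) / ?E) powr (2/5)
          \<le> (3/5) * (norm (f x) / ?A) + (2/5) * (norm (f x) powr (3/2) / ?E)"
        using A E by (intro Youngs_inequality_0) auto
      moreover have "(norm (f x) / ?A) powr (3/5) * (norm (f x) powr (3/2) / ?E) powr (2/5) = norm (f x) powr (6/5) / ?c"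
      proof -
        have "norm (f x) powr (3/5) * norm (f x) powr (3/5) = norm (f x) powr (6/5)"
          by (simp flip: powr_add)
        moreover have "(norm (f x) powr (3/2)) powr (2/5) = norm (f x) powr (3/5)"
          by (simp add: powr_powr)
        ultimately show ?thesis by (simp add: powr_divide)
      qed
      moreover have "0 < ?c" using A E by simp
      ultimately show ?thesis by (simp add: pos_divide_le_eq mult.commute)
    qed simp
    then have "?J \<le> (LINT x|M. ?c * ((3/5) * (norm (f x) / ?A) + (2/5) * (norm (f x) powr (3/2) / ?E)))"
      using assms by (intro integral_mono') auto
    also have "\<dots> = ?c * ((3/5) * (?A / ?A) + (2/5) * (?E / ?E))"
      using assms by simp
    also have "\<dots> = ?c" using A E by simp
    finally show ?thesis .
  qed
  have "(Lp_norm (6/5) M f)\<^sup>2 = ?J powr (5/3)"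
    by (simp add: Lp_norm_def power2_eq_square flip: powr_add)
  also have "\<dots> \<le> (?A powr (3/5) * ?E powr (2/5)) powr (5/3)"
    using J J0 by (intro powr_mono2) auto
  also have "\<dots> = ?A * ?E powr (2/3)"
    using A0 by (simp add: powr_mult powr_powr)
  also have "\<dots> = Lp_norm 1 M f * Lp_norm (3/2) M f"
    by (simp add: Lp_norm_def)
  finally show ?thesis .
qed

lemma Linfty_lebesgue_on:
  assumes "Linfty lebesgue f" "B \<in> sets lebesgue"
  shows "f \<in> borel_measurable (lebesgue_on B)" "\<exists>C. AE x in lebesgue_on B. norm (f x) \<le> C"
  using assms by (auto simp: Linfty_def measurable_restrict_space1 AE_restrict_space_iff)

lemma norm_L2_inner_weighted_le:
  assumes "integrable M (\<lambda>x. norm (q x))" "C \<ge> 0" "AE x in M. q x \<noteq> 0 \<longrightarrow> norm (u x) \<le> C"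
  shows "norm (L2_inner M (\<lambda>x. q x * u x) u) \<le> C\<^sup>2 * Lp_norm 1 M q"
proof -
  have "norm (L2_inner M (\<lambda>x. q x * u x) u) \<le> (LINT x|M. norm (q x * u x * cnj (u x)))"
    unfolding L2_inner_def by (rule integral_norm_bound)
  also have "\<dots> \<le> (LINT x|M. C\<^sup>2 * norm (q x))"
  proof (rule integral_mono_AE')
    show "integrable M (\<lambda>x. C\<^sup>2 * norm (q x))" using assms by simp
    show "AE x in M. norm (q x * u x * cnj (u x)) \<le> C\<^sup>2 * norm (q x)"
      using assms(3)
    proof eventually_elim
      case (elim x)
      show ?case
      proof (cases "q x = 0")
        case False
        then have "norm (u x) * norm (u x) \<le> C\<^sup>2"
          unfolding power2_eq_square using elim assms(2) by (intro mult_mono) auto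
        from mult_left_mono[OF this, of "norm (q x)"] show ?thesis
          by (simp add: norm_mult mult.assoc mult.commute[of "C\<^sup>2"])
      qed simp
    qed
  qed simp
  also have "\<dots> = C\<^sup>2 * Lp_norm 1 M q" by (simp add: Lp_norm_1)
  finally show ?thesis .
qed

theorem corollary20:
  fixes B D :: "(real^'n::finite) set"
    and k \<delta> \<alpha> :: real
    and \<mu> :: "nat \<Rightarrow> real"
    and Y :: "nat \<Rightarrow> real^'n \<Rightarrow> complex"
    and n :: "real \<Rightarrow> real^'n \<Rightarrow> complex"
    and lam0 :: complex
    and u0 :: "real^'n \<Rightarrow> complex"
    and lam :: "real \<Rightarrow> complex"
  assumes dim: "CARD('n) = 2 \<or> CARD('n) = 3"
    and B_domain: "bounded_domain B" "connected (- closure B)" "smooth_boundary B"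
    and B_bdry_2: "CARD('n) = 2 \<Longrightarrow> connected (frontier B)"
    and B_bdry_3: "CARD('n) = 3 \<Longrightarrow> simply_connected (frontier B)"
    and D_domain: "bounded_domain D" "connected (- closure D)" "lipschitz_boundary D" "closure D \<subseteq> B"
    and params: "k > 0" "\<delta> \<ge> 0" "\<alpha> > 0"
    and basis: "laplace_beltrami_eigenbasis B \<mu> Y"
    and n_bounded: "\<And>h. h \<ge> 0 \<Longrightarrow> Linfty lebesgue (n h)"
    and n_D: "\<And>h. h \<ge> 0 \<Longrightarrow> AE x in lebesgue_on D. Re (n h x) \<ge> \<alpha> \<and> Im (n h x) \<ge> 0"
    and n_outside: "\<And>h. h \<ge> 0 \<Longrightarrow> AE x in lebesgue_on (B - closure D). n h x = 1"
    and n_conv: "((\<lambda>h. Lp_norm (3/2) (lebesgue_on B) (\<lambda>x. n h x - n 0 x)) \<longlongrightarrow> 0) (at_right 0)"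
    and no_dirichlet: "\<not> (\<exists>w\<in>H1 B. \<not> ae_eq_on B w (\<lambda>_. 0) \<and>
          weak_helmholtz B k (n 0) w \<and> has_trace B w (\<lambda>_. 0))"
    and simple0: "simple_stekloff_eigenvalue B k \<mu> Y \<delta> (n 0) lam0"
    and eigenfunction0: "stekloff_eigenfunction B k \<mu> Y \<delta> (n 0) lam0 u0"
    and normalized: "H1_norm B k u0 = 1"
    and simple_h: "\<forall>\<^sub>F h in at_right 0. simple_stekloff_eigenvalue B k \<mu> Y \<delta> (n h) (lam h)"
    and expansion_2: "CARD('n) = 2 \<Longrightarrow> \<forall>\<epsilon>>0.
          (\<lambda>h. norm (lam h - (lam0 + of_real (k\<^sup>2) *
                L2_inner (lebesgue_on B) (\<lambda>x. (n h x - n 0 x) * u0 x) u0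
                  / smoothing_form B \<mu> Y \<delta> u0 u0)))
          \<in> O[at_right 0](\<lambda>h. (Lp_norm (1 + \<epsilon>) (lebesgue_on B) (\<lambda>x. n h x - n 0 x))\<^sup>2)"
    and expansion_3: "CARD('n) = 3 \<Longrightarrow>
          (\<lambda>h. norm (lam h - (lam0 + of_real (k\<^sup>2) *
                L2_inner (lebesgue_on B) (\<lambda>x. (n h x - n 0 x) * u0 x) u0
                  / smoothing_form B \<mu> Y \<delta> u0 u0)))
          \<in> O[at_right 0](\<lambda>h. (Lp_norm (6/5) (lebesgue_on B) (\<lambda>x. n h x - n 0 x))\<^sup>2)"
  shows "\<exists>C. \<forall>\<^sub>F h in at_right 0.
           norm (lam h - lam0) \<le> C * Lp_norm 1 (lebesgue_on B) (\<lambda>x. n h x - n 0 x)"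
proof -
  let ?M = "lebesgue_on B"
  let ?q = "\<lambda>h x. n h x - n 0 x"
  let ?S = "smoothing_form B \<mu> Y \<delta> u0 u0"
  let ?I = "\<lambda>h. L2_inner ?M (\<lambda>x. ?q h x * u0 x) u0"
  let ?L = "\<lambda>p h. Lp_norm p ?M (?q h)"
  have B: "open B" "bounded B" using B_domain(1) by (auto simp: bounded_domain_def)
  have Bs: "B \<in> sets lebesgue" "B - closure D \<in> sets lebesgue" using B(1) by auto
  interpret finite_measure ?M by (rule finite_measure_lebesgue_on_bounded[OF B])
  have u0: "u0 \<in> H1 B" "weak_helmholtz B k (n 0) u0" "L2 ?M u0"
    using eigenfunction0 by (auto simp: stekloff_eigenfunction_def H1_def)
  note nh = Linfty_lebesgue_on[OF n_bounded Bs(1)]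
  obtain C0 where "AE x in ?M. norm (n 0 x) \<le> C0" using nh(2)[of 0] by auto
  then have "L2 ?M (\<lambda>x. u0 x * n 0 x)"
    using u0(3) nh(1)[of 0] by (intro L2_mult_bounded) auto
  then have nu0: "L2 ?M (\<lambda>x. n 0 x * u0 x)" by (simp add: mult.commute)
  have "compact (closure D)" using D_domain(1) by (simp add: bounded_domain_def)
  then obtain A where A: "A \<ge> 0" "AE x in ?M. x \<in> closure D \<longrightarrow> norm (u0 x) \<le> A"
    using weak_helmholtz_bounded_on_compact[OF dim B u0(1,2) nu0 _ D_domain(4)] by blast
  have q_int: "integrable ?M (\<lambda>x. norm (?q h x) powr p)" if h: "h \<ge> 0" and p: "p \<ge> 0" for h p
  proof -
    obtain C where C: "AE x in ?M. norm (n h x) \<le> C" using nh(2)[OF h] by auto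
    have "AE x in ?M. norm (norm (?q h x) powr p) \<le> (C + C0) powr p"
      using C \<open>AE x in ?M. norm (n 0 x) \<le> C0\<close>
    proof eventually_elim
      case (elim x)
      then have "norm (?q h x) \<le> C + C0"
        using norm_triangle_ineq4[of "n h x" "n 0 x"] by linarith
      then show ?case using p by (simp add: powr_mono2)
    qed
    then show ?thesis
      using nh(1)[OF h] nh(1)[of 0] by (intro integrable_const_bound) auto
  qed
  have first_order: "norm (?I h) \<le> A\<^sup>2 * ?L 1 h" if h: "h \<ge> 0" for h
  proof (rule norm_L2_inner_weighted_le)
    show "integrable ?M (\<lambda>x. norm (?q h x))" using q_int[OF h, of 1] by simp
    \<comment> \<open>The perturbation is supported in the closure of \<open>D\<close>, a compact subset of \<open>B\<close> on which \<open>u0\<close> is bounded.\<close>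
    have "AE x in lebesgue. x \<in> B - closure D \<longrightarrow> n h x = 1" "AE x in lebesgue. x \<in> B - closure D \<longrightarrow> n 0 x = 1"
      using n_outside[OF h] n_outside[of 0] Bs(2) by (auto simp: AE_restrict_space_iff)
    then have "AE x in lebesgue. x \<in> B \<longrightarrow> ?q h x \<noteq> 0 \<longrightarrow> x \<in> closure D"
      by eventually_elim auto
    then have "AE x in ?M. ?q h x \<noteq> 0 \<longrightarrow> x \<in> closure D"
      using Bs(1) by (simp add: AE_restrict_space_iff)
    then show "AE x in ?M. ?q h x \<noteq> 0 \<longrightarrow> norm (u0 x) \<le> A"
      using A(2) by eventually_elim blast
  qed (rule A(1))
  \<comment> \<open>In the plane \<open>\<epsilon> = 1/5\<close> yields the same exponent \<open>6/5\<close> as in space.\<close>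
  have "(\<lambda>h. norm (lam h - (lam0 + of_real (k\<^sup>2) * ?I h / ?S))) \<in> O[at_right 0](\<lambda>h. (?L (6/5) h)\<^sup>2)"
    using dim expansion_3 expansion_2[THEN spec, of "1/5"] by auto
  then obtain c where c: "c > 0"
    "\<forall>\<^sub>F h in at_right 0. norm (norm (lam h - (lam0 + of_real (k\<^sup>2) * ?I h / ?S))) \<le> c * norm ((?L (6/5) h)\<^sup>2)"
    by (rule landau_o.bigE)
  have small: "\<forall>\<^sub>F h in at_right 0. ?L (3/2) h < 1"
    using order_tendstoD(2)[OF n_conv] by simp
  have "\<forall>\<^sub>F h in at_right 0. norm (lam h - lam0) \<le> (c + k\<^sup>2 * A\<^sup>2 / norm ?S) * ?L 1 h"
    using c(2) small eventually_at_right_less[of 0]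
  proof eventually_elim
    case (elim h)
    let ?X = "of_real (k\<^sup>2) * ?I h / ?S"
    have h: "h \<ge> 0" using elim by simp
    have L1: "0 \<le> ?L 1 h" by (simp add: Lp_norm_1)
    have "(?L (6/5) h)\<^sup>2 \<le> ?L 1 h * ?L (3/2) h"
      using q_int[OF h, of 1] q_int[OF h, of "3/2"] by (intro Lp_norm_interpolation) auto
    also have "\<dots> \<le> ?L 1 h" using L1 elim(2) by (simp add: mult_left_le)
    finally have "c * (?L (6/5) h)\<^sup>2 \<le> c * ?L 1 h" using c(1) by simp
    then have remainder: "norm (lam h - (lam0 + ?X)) \<le> c * ?L 1 h" using elim(1) by simp
    have "norm ?X = k\<^sup>2 / norm ?S * norm (?I h)" by (simp add: norm_mult norm_divide norm_power)
    also have "\<dots> \<le> k\<^sup>2 / norm ?S * (A\<^sup>2 * ?L 1 h)"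
      by (intro mult_left_mono first_order h) simp
    finally have "norm ?X \<le> k\<^sup>2 * A\<^sup>2 / norm ?S * ?L 1 h" by simp
    moreover have "norm (lam h - lam0) \<le> norm (lam h - (lam0 + ?X)) + norm ?X"
      using norm_triangle_ineq[of "lam h - (lam0 + ?X)" ?X] by simp
    ultimately show ?case using remainder by (simp add: ring_distribs)
  qed
  then show ?thesis by blast
qed

end
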